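(* Let $n\geqslant2$, let $\mathbb{S}$ be the unit sphere of $\mathbb{R}^n$, and let $e_n\in\mathbb{S}$. Let $f_0$ be a probability measure on $\mathbb{S}$ having a density with respect to the Lebesgue measure on $\mathbb{S}$ that satisfies $m\leqslant f_0(v)\leqslant M$ for all $v\in\mathbb{S}$, for some constants $0<m<M$. Let $f$ be the solution of $$\partial_tf+\nabla_v\cdot(fP_{v^\perp}J_f)=0,\qquad J_f(t)=\int_{\mathbb{S}}v\,f(t,v)\,\mathrm{d}v,$$ with initial condition $f_0$. Suppose that $J_{f_0}=\int_{\mathbb{S}}v f_0(v)\,\mathrm{d}v\neq0$ and that $\Omega(t)=\frac{J_f(t)}{|J_f(t)|}$ is constant in time, equal to $e_n$. Then $$W_1(f(t,\cdot),\delta_{e_n})\asymp\begin{cases}(1+t)e^{-t}&\text{if }n=2,\\ e^{-t}&\text{if }n\geqslant3,\end{cases}$$ $$W_2(f(t,\cdot),\delta_{e_n})\asymp\begin{cases}e^{-\frac12t}&\text{if }n=2,\\ \sqrt{1+t}\,e^{-t}&\text{if }n=3,\\ e^{-t}&\text{if }n\geqslant4.\end{cases}$$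
   Context: For $v\in\mathbb{S}$ and $u\in\mathbb{R}^n$, $P_{v^\perp}u=u-(v\cdot u)v$. $\nabla_v$ and $\nabla_v\cdot$ are the gradient and divergence on $\mathbb{S}$. $\mathcal{P}(\mathbb{S})$ is the set of Borel probability measures on $\mathbb{S}$. The solution is the unique weakly continuous family $f\in C(\mathbb{R}_+,\mathcal{P}(\mathbb{S}))$ with $f(0,\cdot)=f_0$ such that for all $t\geqslant0$ and $\varphi\in C^1(\mathbb{S})$, $\frac{\mathrm{d}}{\mathrm{d}t}\int_{\mathbb{S}}\varphi(v)f(t,v)\,\mathrm{d}v=\int_{\mathbb{S}}J_f(t)\cdot\nabla_v\varphi(v)f(t,v)\,\mathrm{d}v$ (where $f(t,v)\,\mathrm{d}v$ denotes integration against the measure $f(t,\cdot)$). When $J_{f_0}\ne0$, $J_f(t)\neq0$ for all $t\geqslant0$ since $|J_f|$ is nondecreasing, so $\Omega(t)$ is well-defined. One writes $a(t)\asymp b(t)$ when there exist two positive constants $c_1,c_2$ such that $c_1b(t)\leqslant a(t)\leqslant c_2b(t)$ for all $t\geqslant0$. The Wasserstein distances are defined with the Euclidean norm of $\mathbb{R}^n$: $W_1(\mu,\nu)=\sup_{\varphi\in\mathrm{Lip}_1(\mathbb{S})}\left|\int_{\mathbb{S}}\varphi\,\mathrm{d}\mu-\int_{\mathbb{S}}\varphi\,\mathrm{d}\nu\right|$, where $\mathrm{Lip}_1(\mathbb{S})$ is the set of $\varphi:\mathbb{S}\to\mathbb{R}$ with $|\varphi(u)-\varphi(v)|\leqslant|u-v|$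 for all $u,v\in\mathbb{S}$; and $W_2^2(\mu,\nu)=\inf_\pi\int_{\mathbb{S}\times\mathbb{S}}|v-w|^2\,\mathrm{d}\pi(v,w)$, the infimum being over probability measures $\pi$ on $\mathbb{S}\times\mathbb{S}$ with first and second marginals $\mu$ and $\nu$. *)

theory Defs
  imports "HOL-Probability.Probability"
begin

abbreviation unit_sphere :: "('a::real_normed_vector) set" where
  "unit_sphere \<equiv> sphere 0 1"

abbreviation sphere_borel :: "('a::euclidean_space) measure" where
  "sphere_borel \<equiv> restrict_space borel unit_sphere"

definition sphere_prob :: "('a::euclidean_space) measure set" where
  "sphere_prob = {\<mu>. prob_space \<mu> \<and> sets \<mu> = sets sphere_borel}"

text \<open>The (unnormalised) surface measure, from integration in polar coordinates: the measure of
  \<open>A\<close> is the dimension times the Lebesgue measure of the cone of all \<open>r *\<^sub>R v\<close> with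
  \<open>0 < r < 1\<close> and \<open>v \<in> A\<close>; see \<open>emeasure_sphere_measure\<close> below.\<close>

definition sphere_measure :: "('a::euclidean_space) measure" where
  "sphere_measure =
     scale_measure (of_nat DIM('a))
       (distr (restrict_space lborel (ball 0 1 - {0})) sphere_borel (\<lambda>x. x /\<^sub>R norm x))"

lemma emeasure_sphere_measure:
  fixes A :: "('a::euclidean_space) set"
  assumes "A \<in> sets sphere_borel"
  shows "emeasure sphere_measure A =
    of_nat DIM('a) * emeasure lborel {r *\<^sub>R v | r v. 0 < r \<and> r < 1 \<and> v \<in> A}"
proof -
  let ?p = "\<lambda>x::'a. x /\<^sub>R norm x"
  have "?p \<in> borel_measurable borel" by measurable
  then have p: "?p \<in> measurable (restrict_space lborel (ball 0 1 - {0})) sphere_borel"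
    by (intro measurable_restrict_space2 measurable_restrict_space1)
      (auto simp: space_restrict_space)
  have A: "A \<subseteq> sphere 0 1"
    using sets.sets_into_space[OF assms] by (simp add: space_restrict_space)
  have "?p -` A \<inter> space (restrict_space lborel (ball 0 1 - {0})) =
      {r *\<^sub>R v | r v. 0 < r \<and> r < 1 \<and> v \<in> A}" (is "?L = ?R")
  proof
    show "?L \<subseteq> ?R"
    proof
      fix x assume x: "x \<in> ?L"
      then have "x = norm x *\<^sub>R ?p x" "0 < norm x" "norm x < 1" "?p x \<in> A"
        by (auto simp: space_restrict_space)
      then show "x \<in> ?R" by blast
    qed
    show "?R \<subseteq> ?L"
      using A by (auto simp: space_restrict_space subset_iff)
  qed
  moreover have "?R \<subseteq> ball 0 1 - {0}"
    using A by (auto simp: subset_iff)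
  ultimately show ?thesis
    unfolding sphere_measure_def
    using assms p by (simp add: emeasure_distr emeasure_restrict_space)
qed

text \<open>The gradient on the sphere of a function of which only the values on the sphere matter: the
  tangent vector representing its derivative along the sphere.\<close>

definition has_sphere_gradient ::
  "('a::euclidean_space \<Rightarrow> real) \<Rightarrow> 'a \<Rightarrow> 'a \<Rightarrow> bool" where
  "has_sphere_gradient \<phi> g v \<longleftrightarrow>
     g \<bullet> v = 0 \<and> (\<phi> has_derivative (\<lambda>h. g \<bullet> h)) (at v within unit_sphere)"

definition sphere_gradient :: "('a::euclidean_space \<Rightarrow> real) \<Rightarrow> 'a \<Rightarrow> 'a" where
  "sphere_gradient \<phi> v = (THE g. has_sphere_gradient \<phi> g v)"

lemma has_sphere_gradient_unique:
  fixes v :: "'a::euclidean_space"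
  assumes v: "v \<in> unit_sphere"
    and g: "has_sphere_gradient \<phi> g v" and g': "has_sphere_gradient \<phi> g' v"
  shows "g = g'"
proof (rule ccontr)
  assume "g \<noteq> g'"
  define d where "d = g - g'"
  define e where "e = d /\<^sub>R norm d"
  have d: "d \<noteq> 0" "d \<bullet> v = 0"
    using \<open>g \<noteq> g'\<close> g g' by (auto simp: d_def has_sphere_gradient_def inner_diff_left)
  then have e: "e \<bullet> e = 1" "e \<bullet> v = 0" "v \<bullet> e = 0" "d \<bullet> e = norm d"
    by (auto simp: e_def inner_commute dot_square_norm power2_eq_square)
  have vv: "v \<bullet> v = 1" using v by (simp add: dot_square_norm)
  define c where "c = (\<lambda>s::real. cos s *\<^sub>R v + sin s *\<^sub>R e)"
  have "c s \<bullet> c s = (cos s)\<^sup>2 + (sin s)\<^sup>2" for s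
    by (simp add: c_def inner_add_left inner_add_right e vv power2_eq_square)
  then have c: "range c \<subseteq> unit_sphere"
    by (auto simp: norm_eq_1)
  have "((\<lambda>x. \<phi> x - \<phi> x) has_derivative (\<lambda>h. g \<bullet> h - g' \<bullet> h)) (at v within unit_sphere)"
    using g g' by (intro has_derivative_diff) (auto simp: has_sphere_gradient_def)
  then have "((\<lambda>x. 0::real) has_derivative (\<lambda>h. d \<bullet> h)) (at (c 0) within range c)"
    using c by (auto simp: d_def inner_diff_left c_def intro: has_derivative_subset)
  moreover have "(c has_derivative (\<lambda>s. s *\<^sub>R e)) (at 0)"
    unfolding c_def by (auto intro!: derivative_eq_intros)
  ultimately have "((\<lambda>s. 0::real) has_derivative (\<lambda>s. d \<bullet> (s *\<^sub>R e))) (at (0::real))"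
    using has_derivative_in_compose by blast
  then have "(\<lambda>s. d \<bullet> (s *\<^sub>R e)) = (\<lambda>s::real. 0)"
    using has_derivative_unique has_derivative_const by blast
  from fun_cong[OF this, of 1] show False
    using e d by simp
qed

definition C1_sphere :: "('a::euclidean_space \<Rightarrow> real) set" where
  "C1_sphere =
     {\<phi>. (\<forall>v\<in>unit_sphere. \<exists>g. has_sphere_gradient \<phi> g v) \<and>
         continuous_on unit_sphere (sphere_gradient \<phi>)}"

definition flux :: "('a::euclidean_space) measure \<Rightarrow> 'a" where
  "flux \<mu> = (\<integral>v. v \<partial>\<mu>)"

text \<open>Measure-valued solutions of \<open>\<partial>\<^sub>t f + div (f P J) = 0\<close>, where \<open>J\<close> is the flux of \<open>f\<close> and \<open>P\<close> the
  projection onto the tangent space. The projection disappears in the weak form because the gradient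
  is tangent. The time derivative at \<open>0\<close> is one-sided.\<close>

definition is_solution ::
  "('a::euclidean_space) measure \<Rightarrow> (real \<Rightarrow> 'a measure) \<Rightarrow> bool" where
  "is_solution f0 f \<longleftrightarrow>
     (\<forall>t\<ge>0. f t \<in> sphere_prob) \<and>
     (\<forall>\<phi>::'a \<Rightarrow> real. continuous_on unit_sphere \<phi> \<longrightarrow>
        continuous_on {0..} (\<lambda>t. \<integral>v. \<phi> v \<partial>f t)) \<and>
     f 0 = f0 \<and>
     (\<forall>t\<ge>0. \<forall>\<phi>\<in>C1_sphere.
        ((\<lambda>s. \<integral>v. \<phi> v \<partial>f s) has_real_derivative
           (\<integral>v. flux (f t) \<bullet> sphere_gradient \<phi> v \<partial>f t)) (at t within {0..}))"

definition W1 :: "('a::euclidean_space) measure \<Rightarrow> 'a measure \<Rightarrow> real" where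
  "W1 \<mu> \<nu> = (SUP \<phi>\<in>{\<phi>. 1-lipschitz_on unit_sphere \<phi>}. \<bar>(\<integral>v. \<phi> v \<partial>\<mu>) - (\<integral>v. \<phi> v \<partial>\<nu>)\<bar>)"

definition couplings ::
  "('a::euclidean_space) measure \<Rightarrow> 'a measure \<Rightarrow> ('a \<times> 'a) measure set" where
  "couplings \<mu> \<nu> =
     {\<pi>. prob_space \<pi> \<and> sets \<pi> = sets (sphere_borel \<Otimes>\<^sub>M sphere_borel) \<and>
         distr \<pi> sphere_borel fst = \<mu> \<and> distr \<pi> sphere_borel snd = \<nu>}"

definition W2 :: "('a::euclidean_space) measure \<Rightarrow> 'a measure \<Rightarrow> real" where
  "W2 \<mu> \<nu> = sqrt (INF \<pi>\<in>couplings \<mu> \<nu>. \<integral>(v, w). (norm (v - w))\<^sup>2 \<partial>\<pi>)"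

definition same_order :: "(real \<Rightarrow> real) \<Rightarrow> (real \<Rightarrow> real) \<Rightarrow> bool" (infix "\<asymp>" 50) where
  "a \<asymp> b \<longleftrightarrow> (\<exists>c1>0. \<exists>c2>0. \<forall>t\<ge>0. c1 * b t \<le> a t \<and> a t \<le> c2 * b t)"

end

theory Submission imports Defs begin

text \<open>
  Write \<open>h v = (1 + v \<bullet> e) / 2\<close> for the height of a point of the sphere above the antipode \<open>-e\<close>, so that
  \<open>\<bar>v - e\<bar>\<^sup>2 = 4 (1 - h v)\<close>. Since the target is a Dirac mass, both distances are explicit: \<open>W1\<close> is the
  integral of \<open>\<bar>v - e\<bar>\<close>, because that function is itself 1-Lipschitz, and \<open>W2\<^sup>2\<close> is the integral of
  \<open>\<bar>v - e\<bar>\<^sup>2\<close>, because there is only one coupling (\<open>W1_return\<close>, \<open>W2_return\<close>). Everything therefore depends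
  only on the distribution of the height.

  If the flux is \<open>j(t) e\<close>, characteristics satisfy \<open>h' = 2 j h (1 - h)\<close>. With the clock
  \<open>S(t) = \<integral>\<^sub>0\<^sup>t j\<close> and \<open>a = exp (-2 S(t))\<close>, this logistic equation is solved by the Moebius map
  \<open>h \<mapsto> h / (h + a (1 - h))\<close>. Lemma \<open>transport\<close> derives from the weak formulation that the height
  distribution at time \<open>t\<close> is the image of the initial one under this map: for a test function composed with
  the flow from time \<open>s\<close> to time \<open>t\<close>, the integral at time \<open>s\<close> does not depend on \<open>s\<close>. Consequently \<open>W1\<close> and \<open>W2\<^sup>2\<close> are multiples
  of the integrals over \<open>f0\<close> of the powers \<open>1/2\<close> and \<open>1\<close> of
  \<open>a (1 - h) / (h + a (1 - h))\<close>, which behaves like \<open>min 1 (a / h)\<close>.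

  The density bounds enter only through the caps \<open>h \<le> r\<close> around \<open>-e\<close>, which have mass of order \<open>r\<^sup>\<alpha>\<close> with
  \<open>\<alpha> = (n - 1) / 2\<close> (\<open>density_cap_bounds\<close>). A layer-cake formula then shows that the integral of the
  \<open>\<beta>\<close>-th power is of order \<open>a\<^sup>\<beta> (1 + \<beta> \<integral>\<^sub>a\<^sup>1 r\<^bsup>\<alpha> - \<beta> - 1\<^esup> dr)\<close>
  (\<open>defect_integral_le\<close>, \<open>defect_integral_ge\<close>). This is of order \<open>a\<^sup>\<beta>\<close> if \<open>\<beta> < \<alpha>\<close>,
  \<open>a\<^sup>\<beta> (1 + ln (1 / a))\<close> if \<open>\<beta> = \<alpha>\<close> and \<open>a\<^sup>\<alpha>\<close> if \<open>\<alpha> < \<beta>\<close>, which is where the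
  critical dimensions \<open>2\<close> for \<open>W1\<close> and \<open>3\<close> for \<open>W2\<close> come from.

  It remains to replace \<open>S(t)\<close> by \<open>t\<close>. Heights only increase, so \<open>j \<ge> j(0) > 0\<close> and \<open>S\<close> grows at least
  linearly; moreover \<open>1 - j\<close> is twice the integral with \<open>\<beta> = 1\<close>, hence at most of order
  \<open>a\<^bsup>1/2\<^esup> = exp (-S(t))\<close> in every dimension. So \<open>1 - j\<close> is integrable and \<open>t - S(t)\<close> stays
  bounded (\<open>clock_linear\<close>).
\<close>

section \<open>The height above the antipode and the distances to a Dirac mass\<close>

text \<open>The affine normalisation of \<open>v \<bullet> e\<close> to \<open>[0, 1]\<close>. It turns the equation for the characteristics into
  the logistic equation and makes small heights correspond to small caps around \<open>-e\<close>.\<close>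

definition height :: "'a::euclidean_space \<Rightarrow> 'a \<Rightarrow> real" where
  "height e v = (1 + v \<bullet> e) / 2"

lemma height_bounds:
  assumes "e \<in> unit_sphere" "v \<in> unit_sphere"
  shows "0 \<le> height e v" "height e v \<le> 1"
  using Cauchy_Schwarz_ineq2[of v e] assms by (auto simp: height_def)

lemma norm_diff_height:
  assumes "e \<in> unit_sphere" "v \<in> unit_sphere"
  shows "(norm (v - e))\<^sup>2 = 4 * (1 - height e v)" "norm (v - e) = 2 * sqrt (1 - height e v)"
proof -
  show *: "(norm (v - e))\<^sup>2 = 4 * (1 - height e v)"
    using assms by (simp add: power2_norm_eq_inner height_def inner_diff_left inner_diff_right
        inner_commute[of e v] field_simps) (simp add: dot_square_norm)
  have "norm (v - e) = sqrt ((norm (v - e))\<^sup>2)" by simp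
  then show "norm (v - e) = 2 * sqrt (1 - height e v)"
    unfolding * by (simp only: real_sqrt_mult real_sqrt_four)
qed

lemma continuous_on_height [continuous_intros]: "continuous_on A (height e)"
  unfolding height_def by (intro continuous_intros) simp

lemma sphere_prob_space:
  assumes "\<mu> \<in> sphere_prob"
  shows "space \<mu> = unit_sphere" "sets \<mu> = sets sphere_borel" "prob_space \<mu>"
  using assms sets_eq_imp_space_eq[of \<mu> sphere_borel]
  by (auto simp: sphere_prob_def space_restrict_space)

lemma sphere_prob_measurable:
  fixes \<phi> :: "'a::euclidean_space \<Rightarrow> real"
  assumes "\<mu> \<in> sphere_prob" "continuous_on unit_sphere \<phi>"
  shows "\<phi> \<in> borel_measurable \<mu>"
  using borel_measurable_continuous_on_restrict[OF assms(2)] sphere_prob_space(2)[OF assms(1)]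
  by (simp cong: measurable_cong_sets)

text \<open>The sphere is compact, so continuous functions on it are bounded.\<close>

lemma sphere_prob_integrable:
  fixes \<phi> :: "'a::euclidean_space \<Rightarrow> real"
  assumes "\<mu> \<in> sphere_prob" "continuous_on unit_sphere \<phi>"
  shows "integrable \<mu> \<phi>"
proof -
  interpret prob_space \<mu> using sphere_prob_space(3)[OF assms(1)] .
  have "compact (\<phi> ` unit_sphere)"
    by (rule compact_continuous_image[OF assms(2)]) simp
  then obtain B where "\<And>v. v \<in> unit_sphere \<Longrightarrow> norm (\<phi> v) \<le> B"
    using compact_imp_bounded bounded_iff by (metis imageI)
  then show ?thesis
    using sphere_prob_measurable[OF assms] sphere_prob_space(1)[OF assms(1)]
    by (intro integrable_const_bound[where B = B]) auto
qed

text \<open>A 1-Lipschitz function differs from its value at \<open>e\<close> by at most \<open>\<bar>v - e\<bar>\<close>, and the distance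
  to \<open>e\<close> is 1-Lipschitz itself, so it attains the supremum.\<close>

lemma W1_return:
  fixes \<mu> :: "'a::euclidean_space measure"
  assumes \<mu>: "\<mu> \<in> sphere_prob" and e: "e \<in> unit_sphere"
  shows "W1 \<mu> (return sphere_borel e) = (\<integral>v. norm (v - e) \<partial>\<mu>)"
proof -
  interpret prob_space \<mu> using sphere_prob_space(3)[OF \<mu>] .
  let ?L = "{\<phi> :: 'a \<Rightarrow> real. 1-lipschitz_on unit_sphere \<phi>}"
  define F where "F \<phi> = \<bar>(\<integral>v. \<phi> v \<partial>\<mu>) - (\<integral>v. \<phi> v \<partial>return sphere_borel e)\<bar>" for \<phi> :: "'a \<Rightarrow> real"
  have cont: "continuous_on unit_sphere \<phi>" if "\<phi> \<in> ?L" for \<phi> :: "'a \<Rightarrow> real"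
    using that by (auto intro: lipschitz_on_continuous_on)
  have nc: "continuous_on unit_sphere (\<lambda>v. norm (v - e))" by (intro continuous_intros)
  have ret: "(\<integral>v. \<phi> v \<partial>return sphere_borel e) = \<phi> e" if "continuous_on unit_sphere \<phi>"
    for \<phi> :: "'a \<Rightarrow> real"
    using e borel_measurable_continuous_on_restrict[OF that]
    by (intro integral_return) (auto simp: space_restrict_space)
  have F: "F \<phi> = \<bar>\<integral>v. \<phi> v - \<phi> e \<partial>\<mu>\<bar>" if "continuous_on unit_sphere \<phi>" for \<phi>
    using that sphere_prob_integrable[OF \<mu> that] by (simp add: F_def ret prob_space)
  have le: "F \<phi> \<le> (\<integral>v. norm (v - e) \<partial>\<mu>)" if "\<phi> \<in> ?L" for \<phi>
  proof -
    have "F \<phi> \<le> (\<integral>v. \<bar>\<phi> v - \<phi> e\<bar> \<partial>\<mu>)"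
      unfolding F[OF cont[OF that]] by (rule integral_abs_bound)
    also have "\<dots> \<le> (\<integral>v. norm (v - e) \<partial>\<mu>)"
    proof (rule integral_mono)
      show "integrable \<mu> (\<lambda>v. \<bar>\<phi> v - \<phi> e\<bar>)"
        by (intro sphere_prob_integrable[OF \<mu>] continuous_intros cont[OF that])
      show "integrable \<mu> (\<lambda>v. norm (v - e))"
        by (intro sphere_prob_integrable[OF \<mu>] nc)
      show "\<bar>\<phi> v - \<phi> e\<bar> \<le> norm (v - e)" if "v \<in> space \<mu>" for v
        using \<open>\<phi> \<in> ?L\<close> that e sphere_prob_space(1)[OF \<mu>]
        by (auto simp: lipschitz_on_def dist_norm)
    qed
    finally show ?thesis .
  qed
  have mem: "(\<lambda>v. norm (v - e)) \<in> ?L"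
    by (auto simp: lipschitz_on_def dist_norm intro: order.trans[OF norm_triangle_ineq3])
  have attained: "F (\<lambda>v. norm (v - e)) = (\<integral>v. norm (v - e) \<partial>\<mu>)"
    by (simp add: F[OF nc])
  show ?thesis
    unfolding W1_def F_def[symmetric]
  proof (rule cSup_eq_maximum)
    show "(\<integral>v. norm (v - e) \<partial>\<mu>) \<in> F ` ?L"
      using mem attained by (metis (no_types, lifting) image_eqI)
  qed (use le in auto)
qed

text \<open>The second component of any coupling is almost surely equal to \<open>e\<close>, so all couplings have the same
  cost; pairing each point with \<open>e\<close> shows that a coupling exists.\<close>

lemma W2_return:
  fixes \<mu> :: "'a::euclidean_space measure"
  assumes \<mu>: "\<mu> \<in> sphere_prob" and e: "e \<in> unit_sphere"
  shows "W2 \<mu> (return sphere_borel e) = sqrt (\<integral>v. (norm (v - e))\<^sup>2 \<partial>\<mu>)"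
proof -
  let ?C = "couplings \<mu> (return sphere_borel e)"
  let ?B = "sphere_borel :: 'a measure"
  interpret prob_space \<mu> using sphere_prob_space(3)[OF \<mu>] .
  have sm: "sets \<mu> = sets ?B" using sphere_prob_space(2)[OF \<mu>] .
  have eB: "e \<in> space ?B" using e by (simp add: space_restrict_space)
  have n: "(\<lambda>v. (norm (v - e))\<^sup>2) \<in> borel_measurable ?B"
    by (intro borel_measurable_continuous_on_restrict continuous_intros)
  have cost: "(\<integral>(v, w). (norm (v - w))\<^sup>2 \<partial>\<pi>) = (\<integral>v. (norm (v - e))\<^sup>2 \<partial>\<mu>)" if \<pi>: "\<pi> \<in> ?C" for \<pi>
  proof -
    have s: "sets \<pi> = sets (?B \<Otimes>\<^sub>M ?B)" and d1: "distr \<pi> ?B fst = \<mu>"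
      and d2: "distr \<pi> ?B snd = return ?B e"
      using \<pi> by (auto simp: couplings_def)
    have [measurable]: "fst \<in> measurable \<pi> ?B" "snd \<in> measurable \<pi> ?B"
      by (simp_all add: measurable_cong_sets[OF s refl])
    have id1: "id \<in> borel_measurable ?B"
      using measurable_restrict_space1[OF measurable_id, of borel "unit_sphere :: 'a set"] by (simp add: id_def)
    have m1: "fst \<in> borel_measurable \<pi>" "snd \<in> borel_measurable \<pi>"
      using measurable_compose[OF \<open>fst \<in> measurable \<pi> ?B\<close> id1]
        measurable_compose[OF \<open>snd \<in> measurable \<pi> ?B\<close> id1] by (auto simp: id_def)
    have sing: "Measurable.pred ?B (\<lambda>w. w = e)"
      by (rule measurable_restrict_space1) measurable
    have "AE w in return ?B e. w = e"
      using eB sing by (subst AE_return) auto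
    then have "AE x in \<pi>. snd x = e"
      unfolding d2[symmetric]
      using AE_distr_iff[OF \<open>snd \<in> measurable \<pi> ?B\<close>, of "\<lambda>w. w = e"] sing by (simp add: pred_def)
    then have "(\<integral>(v, w). (norm (v - w))\<^sup>2 \<partial>\<pi>) = (\<integral>x. (norm (fst x - e))\<^sup>2 \<partial>\<pi>)"
      using m1 by (intro integral_cong_AE) (auto simp: case_prod_beta)
    also have "\<dots> = (\<integral>v. (norm (v - e))\<^sup>2 \<partial>distr \<pi> ?B fst)"
      using n by (subst integral_distr) auto
    finally show ?thesis by (simp add: d1)
  qed
  have idm: "(\<lambda>v. v) \<in> measurable \<mu> ?B"
    by (simp add: measurable_cong_sets[OF sm refl])
  have pm: "(\<lambda>v. (v, e)) \<in> measurable \<mu> (?B \<Otimes>\<^sub>M ?B)"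
    using idm eB by (intro measurable_Pair) auto
  have "distr \<mu> (?B \<Otimes>\<^sub>M ?B) (\<lambda>v. (v, e)) \<in> ?C"
  proof -
    have 1: "distr (distr \<mu> (?B \<Otimes>\<^sub>M ?B) (\<lambda>v. (v, e))) ?B fst = \<mu>"
      using pm sm by (subst distr_distr) (auto simp: comp_def intro: distr_id2)
    have 2: "distr (distr \<mu> (?B \<Otimes>\<^sub>M ?B) (\<lambda>v. (v, e))) ?B snd = return ?B e"
      using pm eB by (subst distr_distr) (auto simp: comp_def distr_const)
    show ?thesis
      using 1 2 prob_space_distr[OF pm] by (auto simp: couplings_def)
  qed
  then have "(\<lambda>\<pi>. \<integral>(v, w). (norm (v - w))\<^sup>2 \<partial>\<pi>) ` ?C = {\<integral>v. (norm (v - e))\<^sup>2 \<partial>\<mu>}"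
    using cost by force
  then show ?thesis by (simp add: W2_def)
qed

section \<open>Transport of the height along the flow\<close>

text \<open>The flow of the logistic equation \<open>y' = 2 j y (1 - y)\<close>, with \<open>a = exp (- 2 \<integral> j)\<close> in place of time:
  it multiplies the ratio \<open>(1 - y) / y\<close> by \<open>a\<close>.\<close>

definition mobius :: "real \<Rightarrow> real \<Rightarrow> real" where
  "mobius a y = y / (y + a * (1 - y))"

lemma mobius_denom_pos:
  assumes "0 < a" "0 \<le> y" "y \<le> (1::real)"
  shows "0 < y + a * (1 - y)"
  using assms by (cases "y = 0") (auto intro: add_pos_nonneg)

lemma mobius_bounds:
  assumes "0 < a" "0 \<le> y" "y \<le> 1"
  shows "0 \<le> mobius a y" "mobius a y \<le> 1"
  using mobius_denom_pos[OF assms] assms by (auto simp: mobius_def)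

lemma mobius_one [simp]: "mobius 1 y = y"
  by (simp add: mobius_def)

lemma mobius_ge:
  assumes "0 < a" "a \<le> 1" "0 \<le> y" "y \<le> 1"
  shows "y \<le> mobius a y"
proof -
  have "y + a * (1 - y) \<le> 1"
    using mult_right_mono[of a 1 "1 - y"] assms by simp
  then have "y * (y + a * (1 - y)) \<le> y" using assms by (intro mult_left_le) auto
  then show ?thesis
    using mobius_denom_pos[of a y] assms by (simp add: mobius_def pos_le_divide_eq)
qed

lemma sphere_gradient_eq:
  assumes "v \<in> unit_sphere" "has_sphere_gradient \<phi> g v"
  shows "sphere_gradient \<phi> v = g"
  unfolding sphere_gradient_def
  using assms has_sphere_gradient_unique by (intro the_equality) auto

text \<open>The ambient gradient of \<open>q \<circ> h\<close> is \<open>(q' / 2) e\<close>; the sphere gradient is its tangential part.\<close>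

lemma has_sphere_gradient_height:
  assumes e: "e \<in> unit_sphere" and v: "v \<in> unit_sphere"
    and q: "(q has_real_derivative d) (at (height e v) within {0..1})"
  shows "has_sphere_gradient (\<lambda>v. q (height e v)) ((d / 2) *\<^sub>R (e - (v \<bullet> e) *\<^sub>R v)) v"
proof -
  have vv: "v \<bullet> v = 1" using v by (simp add: dot_square_norm)
  have "(height e has_derivative (\<lambda>h. (h \<bullet> e) / 2)) (at v within unit_sphere)"
    unfolding height_def by (auto intro!: derivative_eq_intros)
  moreover have "(q has_derivative (\<lambda>x. d * x)) (at (height e v) within height e ` unit_sphere)"
    using q unfolding has_field_derivative_def
    by (rule has_derivative_subset) (use height_bounds[OF e] in auto)
  ultimately have q': "((\<lambda>v. q (height e v)) has_derivative (\<lambda>h. d * ((h \<bullet> e) / 2))) (at v within unit_sphere)"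
    by (rule has_derivative_in_compose)
  \<comment> \<open>The function subtracted here vanishes on the sphere; it removes the radial part.\<close>
  have "((\<lambda>w. q (height e w) - d * (v \<bullet> e) / 4 * (w \<bullet> w - 1)) has_derivative
      (\<lambda>h. ((d / 2) *\<^sub>R (e - (v \<bullet> e) *\<^sub>R v)) \<bullet> h)) (at v within unit_sphere)"
    by (rule has_derivative_eq_rhs[OF has_derivative_diff[OF q']])
      (auto intro!: derivative_eq_intros simp: inner_diff_left inner_commute algebra_simps fun_eq_iff)
  then have "((\<lambda>w. q (height e w)) has_derivative
      (\<lambda>h. ((d / 2) *\<^sub>R (e - (v \<bullet> e) *\<^sub>R v)) \<bullet> h)) (at v within unit_sphere)"
    by (rule has_derivative_transform[OF v, rotated]) (simp add: dot_square_norm)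
  then show ?thesis
    by (simp add: has_sphere_gradient_def inner_diff_left inner_commute[of e v] vv)
qed

text \<open>The weak formulation for functions of the height: the inner product of \<open>j e\<close> with the gradient of
  \<open>q \<circ> h\<close> is \<open>2 j q'(h) h (1 - h)\<close>, so the height evolves autonomously, by the logistic equation.\<close>

lemma solution_height_derivative:
  assumes sol: "is_solution f0 f" and e: "e \<in> unit_sphere" and t: "0 \<le> t"
    and J: "flux (f t) = j *\<^sub>R e"
    and q: "\<And>y. y \<in> {0..1} \<Longrightarrow> (q has_real_derivative q' y) (at y within {0..1})"
    and q': "continuous_on {0..1} q'"
  shows "((\<lambda>s. \<integral>v. q (height e v) \<partial>f s) has_real_derivative
     2 * j * (\<integral>v. q' (height e v) * (height e v * (1 - height e v)) \<partial>f t)) (at t within {0..})"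
proof -
  let ?\<phi> = "\<lambda>v. q (height e v)"
  let ?g = "\<lambda>v. (q' (height e v) / 2) *\<^sub>R (e - (v \<bullet> e) *\<^sub>R v)"
  have g: "has_sphere_gradient ?\<phi> (?g v) v" if "v \<in> unit_sphere" for v
    using height_bounds[OF e that] by (intro has_sphere_gradient_height e that q) simp
  have "continuous_on unit_sphere (\<lambda>v. q' (height e v))"
    using height_bounds[OF e] by (intro continuous_on_compose2[OF q'] continuous_intros) auto
  then have "continuous_on unit_sphere ?g" by (intro continuous_intros) auto
  then have "continuous_on unit_sphere (sphere_gradient ?\<phi>)"
    by (rule continuous_on_eq) (simp add: sphere_gradient_eq[OF _ g])
  then have "?\<phi> \<in> C1_sphere" using g unfolding C1_sphere_def by blast
  then have "((\<lambda>s. \<integral>v. ?\<phi> v \<partial>f s) has_real_derivative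
           (\<integral>v. flux (f t) \<bullet> sphere_gradient ?\<phi> v \<partial>f t)) (at t within {0..})"
    using sol t unfolding is_solution_def by blast
  moreover have "(\<integral>v. flux (f t) \<bullet> sphere_gradient ?\<phi> v \<partial>f t) =
      (\<integral>v. 2 * j * (q' (height e v) * (height e v * (1 - height e v))) \<partial>f t)"
  proof (rule Bochner_Integration.integral_cong[OF refl])
    fix v assume "v \<in> space (f t)"
    then have v: "v \<in> unit_sphere"
      using sol t sphere_prob_space(1) unfolding is_solution_def by blast
    have ee: "e \<bullet> e = 1" using e by (simp add: dot_square_norm)
    show "flux (f t) \<bullet> sphere_gradient ?\<phi> v = 2 * j * (q' (height e v) * (height e v * (1 - height e v)))"
      unfolding sphere_gradient_eq[OF v g[OF v]] J
      by (simp add: inner_diff_right ee height_def inner_commute[of e v] field_simps)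
  qed
  ultimately show ?thesis by simp
qed

text \<open>Uniform continuity of the derivative on a compact neighbourhood makes the first-order expansion in the
  parameter uniform in \<open>y\<close>, so that it can be integrated against a measure that itself varies.\<close>

lemma uniform_parameter_derivative:
  fixes G D :: "real \<Rightarrow> real \<Rightarrow> real"
  assumes G: "\<And>b y. 0 < b \<Longrightarrow> y \<in> {0..1} \<Longrightarrow> ((\<lambda>b. G b y) has_real_derivative D b y) (at b)"
    and D: "continuous_on ({0<..} \<times> {0..1}) (\<lambda>(b, y). D b y)"
    and a: "0 < a" and \<epsilon>: "0 < \<epsilon>"
  shows "\<exists>\<delta>>0. \<forall>b. \<bar>b - a\<bar> < \<delta> \<longrightarrow> (\<forall>y\<in>{0..1}. \<bar>G b y - G a y - (b - a) * D a y\<bar> \<le> \<epsilon> * \<bar>b - a\<bar>)"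
proof -
  let ?K = "{a/2..2*a} \<times> {0..1::real}"
  have "uniformly_continuous_on ?K (\<lambda>(b, y). D b y)"
    using a by (intro compact_uniformly_continuous continuous_on_subset[OF D] compact_Times) auto
  then obtain \<delta> where \<delta>: "\<delta> > 0"
    and uc: "\<And>b y. (b, y) \<in> ?K \<Longrightarrow> (a, y) \<in> ?K \<Longrightarrow> dist (b, y) (a, y) < \<delta> \<Longrightarrow> dist (D b y) (D a y) < \<epsilon>"
    using \<epsilon> unfolding uniformly_continuous_on_def by (metis (no_types, lifting) case_prod_conv)
  let ?\<delta> = "min \<delta> (a/2)"
  have "\<bar>G b y - G a y - (b - a) * D a y\<bar> \<le> \<epsilon> * \<bar>b - a\<bar>" if b: "\<bar>b - a\<bar> < ?\<delta>" and y: "y \<in> {0..1}" for b y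
  proof -
    let ?S = "ball a ?\<delta>"
    have S: "c > 0" "\<bar>c - a\<bar> < \<delta>" "c \<in> {a/2..2*a}" if "c \<in> ?S" for c
      using that a by (auto simp: dist_real_def abs_if split: if_splits)
    have "norm ((G b y - b * D a y) - (G a y - a * D a y)) \<le> \<epsilon> * norm (b - a)"
    proof (rule field_differentiable_bound)
      show "convex ?S" by simp
      show "((\<lambda>b. G b y - b * D a y) has_real_derivative (D c y - D a y)) (at c within ?S)" if "c \<in> ?S" for c
        using S[OF that] y by (auto intro!: derivative_eq_intros DERIV_subset[OF G])
      show "norm (D c y - D a y) \<le> \<epsilon>" if "c \<in> ?S" for c
        using S[OF that] y a uc[of c y] by (auto simp: dist_Pair_Pair dist_real_def)
    qed (use b a \<delta> in \<open>auto simp: dist_real_def abs_minus_commute\<close>)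
    then show ?thesis by (simp add: algebra_simps)
  qed
  then show ?thesis using \<delta> a by (intro exI[of _ ?\<delta>]) auto
qed

text \<open>The product rule for an integral in which both the measure and the test function move. The weak
  formulation provides the derivative for a fixed test function only; the term for the moving test
  function converges because the expansion is uniform and the measures are weakly continuous.\<close>

lemma moving_test_function_derivative:
  fixes G D :: "real \<Rightarrow> real \<Rightarrow> real"
  assumes sol: "is_solution f0 f" and e: "e \<in> unit_sphere" and t: "0 \<le> t"
    and G: "\<And>b y. 0 < b \<Longrightarrow> y \<in> {0..1} \<Longrightarrow> ((\<lambda>b. G b y) has_real_derivative D b y) (at b)"
    and D: "continuous_on ({0<..} \<times> {0..1}) (\<lambda>(b, y). D b y)"
    and Gc: "\<And>b. 0 < b \<Longrightarrow> continuous_on {0..1} (G b)"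
    and \<alpha>: "(\<alpha> has_real_derivative \<alpha>') (at t within {0..})" and pos: "\<And>s. 0 < \<alpha> s"
    and K: "((\<lambda>s. \<integral>v. G (\<alpha> t) (height e v) \<partial>f s) has_real_derivative K') (at t within {0..})"
  shows "((\<lambda>s. \<integral>v. G (\<alpha> s) (height e v) \<partial>f s) has_real_derivative
     K' + \<alpha>' * (\<integral>v. D (\<alpha> t) (height e v) \<partial>f t)) (at t within {0..})"
proof -
  let ?a = "\<alpha> t"
  define F where "F s = (\<integral>v. G (\<alpha> s) (height e v) \<partial>f s)" for s
  define k where "k s = (\<integral>v. G ?a (height e v) \<partial>f s)" for s
  define m where "m s = (\<integral>v. D ?a (height e v) \<partial>f s)" for s
  \<comment> \<open>the remainder of the first-order expansion in the parameter, integrated at time \<open>s\<close>\<close>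
  define R where "R s = F s - k s - (\<alpha> s - ?a) * m s" for s
  have fs: "f s \<in> sphere_prob" if "0 \<le> s" for s
    using sol that by (simp add: is_solution_def)
  have comp: "continuous_on unit_sphere (\<lambda>v. q (height e v))" if "continuous_on {0..1} q" for q :: "real \<Rightarrow> real"
    using height_bounds[OF e] by (intro continuous_on_compose2[OF that] continuous_intros) auto
  have Dc: "continuous_on {0..1} (D b)" if "0 < b" for b
  proof -
    have "continuous_on {0..1} (\<lambda>y. (\<lambda>(b, y). D b y) (b, y))"
      using that by (intro continuous_on_compose2[OF D] continuous_intros) auto
    then show ?thesis by simp
  qed
  have m: "(m \<longlongrightarrow> m t) (at t within {0..})"
  proof -
    have "continuous_on {0..} m"
      using sol comp[OF Dc[OF pos]] unfolding is_solution_def m_def by blast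
    then show ?thesis using t unfolding continuous_on_def by blast
  qed
  have bound: "\<bar>R s\<bar> \<le> \<epsilon> * \<bar>\<alpha> s - ?a\<bar>"
    if s: "0 \<le> s" and le: "\<And>y. y \<in> {0..1} \<Longrightarrow> \<bar>G (\<alpha> s) y - G ?a y - (\<alpha> s - ?a) * D ?a y\<bar> \<le> \<epsilon> * \<bar>\<alpha> s - ?a\<bar>"
    for s \<epsilon>
  proof -
    interpret prob_space "f s" using sphere_prob_space(3)[OF fs[OF s]] .
    have i: "integrable (f s) (\<lambda>v. G (\<alpha> s) (height e v))" "integrable (f s) (\<lambda>v. G ?a (height e v))"
      "integrable (f s) (\<lambda>v. D ?a (height e v))"
      using pos by (auto intro!: sphere_prob_integrable[OF fs[OF s]] comp Gc Dc)
    have "\<bar>R s\<bar> = \<bar>\<integral>v. G (\<alpha> s) (height e v) - G ?a (height e v) - (\<alpha> s - ?a) * D ?a (height e v) \<partial>f s\<bar>"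
      using i by (simp add: R_def F_def k_def m_def)
    also have "\<dots> \<le> (\<integral>v. \<bar>G (\<alpha> s) (height e v) - G ?a (height e v) - (\<alpha> s - ?a) * D ?a (height e v)\<bar> \<partial>f s)"
      by (rule integral_abs_bound)
    also have "\<dots> \<le> (\<integral>v. \<epsilon> * \<bar>\<alpha> s - ?a\<bar> \<partial>f s)"
    proof (rule integral_mono)
      show "\<bar>G (\<alpha> s) (height e v) - G ?a (height e v) - (\<alpha> s - ?a) * D ?a (height e v)\<bar> \<le> \<epsilon> * \<bar>\<alpha> s - ?a\<bar>"
        if "v \<in> space (f s)" for v
        using that height_bounds[OF e, of v] sphere_prob_space(1)[OF fs[OF s]] by (intro le) simp
    qed (use i in simp_all)
    finally show ?thesis by (simp add: prob_space)
  qed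
  have quot: "((\<lambda>s. (\<alpha> s - ?a) / (s - t)) \<longlongrightarrow> \<alpha>') (at t within {0..})"
    using \<alpha> by (simp add: has_field_derivative_iff)
  have nonneg: "\<forall>\<^sub>F s in at t within {0..}. 0 \<le> s \<and> s \<noteq> t"
    by (auto simp: eventually_at_filter)
  have "((\<lambda>s. R s / (s - t)) \<longlongrightarrow> 0) (at t within {0..})"
  proof (rule tendstoI)
    fix \<eta> :: real assume "0 < \<eta>"
    define \<epsilon> where "\<epsilon> = \<eta> / (\<bar>\<alpha>'\<bar> + 1)"
    have \<epsilon>: "0 < \<epsilon>" using \<open>0 < \<eta>\<close> by (simp add: \<epsilon>_def add_nonneg_pos)
    obtain \<delta> where \<delta>: "\<delta> > 0"
      "\<And>b y. \<bar>b - ?a\<bar> < \<delta> \<Longrightarrow> y \<in> {0..1} \<Longrightarrow> \<bar>G b y - G ?a y - (b - ?a) * D ?a y\<bar> \<le> \<epsilon> * \<bar>b - ?a\<bar>"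
      using uniform_parameter_derivative[OF G D pos \<epsilon>] by metis
    have "(\<alpha> \<longlongrightarrow> ?a) (at t within {0..})"
      using has_field_derivative_imp_has_derivative[OF \<alpha>] has_derivative_continuous
      by (auto simp: continuous_within)
    then have "\<forall>\<^sub>F s in at t within {0..}. dist (\<alpha> s) ?a < \<delta>" using \<delta>(1) by (rule tendstoD)
    moreover have "\<forall>\<^sub>F s in at t within {0..}. dist ((\<alpha> s - ?a) / (s - t)) \<alpha>' < 1"
      using quot by (rule tendstoD) simp
    ultimately show "\<forall>\<^sub>F s in at t within {0..}. dist (R s / (s - t)) 0 < \<eta>"
      using nonneg
    proof eventually_elim
      case (elim s)
      then have s: "0 < \<bar>s - t\<bar>" by simp
      have "\<bar>R s\<bar> \<le> \<epsilon> * \<bar>\<alpha> s - ?a\<bar>"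
        using elim by (intro bound \<delta>(2)) (auto simp: dist_real_def)
      then have "\<bar>R s / (s - t)\<bar> \<le> \<epsilon> * \<bar>(\<alpha> s - ?a) / (s - t)\<bar>"
        using s by (simp add: abs_divide divide_right_mono)
      also have "\<bar>(\<alpha> s - ?a) / (s - t)\<bar> < \<bar>\<alpha>'\<bar> + 1"
        using elim(2) unfolding dist_real_def by linarith
      then have "\<epsilon> * \<bar>(\<alpha> s - ?a) / (s - t)\<bar> < \<epsilon> * (\<bar>\<alpha>'\<bar> + 1)"
        using \<epsilon> by (rule mult_strict_left_mono)
      also have "\<dots> = \<eta>" by (simp add: \<epsilon>_def add_nonneg_eq_0_iff)
      finally show ?case by simp
    qed
  qed
  moreover have "((\<lambda>s. (k s - k t) / (s - t)) \<longlongrightarrow> K') (at t within {0..})"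
    using K by (simp add: has_field_derivative_iff k_def)
  ultimately have "((\<lambda>s. R s / (s - t) + (k s - k t) / (s - t) + (\<alpha> s - ?a) / (s - t) * m s)
      \<longlongrightarrow> 0 + K' + \<alpha>' * m t) (at t within {0..})"
    by (intro tendsto_add tendsto_mult quot m)
  moreover have "F t = k t" by (simp add: F_def k_def)
  ultimately have "((\<lambda>s. (F s - F t) / (s - t)) \<longlongrightarrow> K' + \<alpha>' * m t) (at t within {0..})"
    by (simp add: R_def add_divide_distrib[symmetric] diff_divide_distrib[symmetric])
  then show ?thesis
    by (simp add: has_field_derivative_iff F_def[symmetric] m_def[symmetric])
qed

text \<open>The test function is \<open>p\<close> composed with the flow from time \<open>t\<close> to time \<open>T\<close>, that is, with the
  Moebius map of parameter \<open>\<alpha>(t) = exp (2 (S(t) - S(T)))\<close>. This parameter changes from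
  \<open>exp (-2 S(T))\<close> at time \<open>0\<close> to \<open>1\<close>, where the map is the identity, at time \<open>T\<close>. The motion of the measure
  and that of the test function compensate each other. Polynomials are smooth enough for the computation.\<close>

lemma transport_polynomial:
  assumes sol: "is_solution f0 f" and e: "e \<in> unit_sphere"
    and J: "\<And>t. 0 \<le> t \<Longrightarrow> flux (f t) = j t *\<^sub>R e"
    and S: "\<And>t. 0 \<le> t \<Longrightarrow> (S has_real_derivative j t) (at t within {0..})" and S0: "S 0 = 0"
    and p: "real_polynomial_function p" and T: "0 \<le> T"
  shows "(\<integral>v. p (height e v) \<partial>f T) = (\<integral>v. p (mobius (exp (- 2 * S T)) (height e v)) \<partial>f0)"
proof -
  obtain p' where p': "real_polynomial_function p'" "\<And>x. (p has_real_derivative p' x) (at x)"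
    using has_real_derivative_polynomial_function[OF p] by blast
  have cp: "continuous_on A p" "continuous_on A p'" for A
    using p p'(1) by (auto intro: continuous_on_polymonial_function simp: real_polynomial_function_eq)
  define \<alpha> where "\<alpha> t = exp (2 * (S t - S T))" for t
  \<comment> \<open>\<open>D\<close> and \<open>Q\<close> are the partial derivatives of \<open>p (mobius b y)\<close> in \<open>b\<close> and \<open>y\<close>; they satisfy
    \<open>Q b y * (y * (1 - y)) = - b * D b y\<close>, which makes the two contributions cancel.\<close>
  define D where "D b y = - p' (mobius b y) * (y * (1 - y) / (y + b * (1 - y))\<^sup>2)" for b y
  define Q where "Q b y = p' (mobius b y) * (b / (y + b * (1 - y))\<^sup>2)" for b y
  define F where "F t = (\<integral>v. p (mobius (\<alpha> t) (height e v)) \<partial>f t)" for t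
  have nz: "y + b * (1 - y) \<noteq> 0" if "0 < b" "y \<in> {0..1}" for b y :: real
    using mobius_denom_pos[of b y] that by auto
  have cm: "continuous_on ({0<..} \<times> {0..1}) (\<lambda>(b, y). mobius b y)"
    unfolding mobius_def case_prod_beta by (intro continuous_intros) (auto dest: nz)
  have cm1: "continuous_on {0..1} (mobius b)" if "0 < b" for b
    unfolding mobius_def using that by (intro continuous_intros) (auto dest: nz)
  have der_b: "((\<lambda>b. p (mobius b y)) has_real_derivative D b y) (at b)" if "0 < b" "y \<in> {0..1}" for b y
  proof -
    have "((\<lambda>b. mobius b y) has_real_derivative - (y * (1 - y) / (y + b * (1 - y))\<^sup>2)) (at b)"
      unfolding mobius_def using nz[OF that]
      by (auto intro!: derivative_eq_intros simp: power2_eq_square)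
    from DERIV_chain2[OF p'(2) this] show ?thesis by (simp add: D_def)
  qed
  have der_y: "((\<lambda>y. p (mobius b y)) has_real_derivative Q b y) (at y within {0..1})" if "0 < b" "y \<in> {0..1}" for b y
  proof -
    have "((\<lambda>y. mobius b y) has_real_derivative (b / (y + b * (1 - y))\<^sup>2)) (at y within {0..1})"
      unfolding mobius_def using nz[OF that]
      by (auto intro!: derivative_eq_intros simp: power2_eq_square algebra_simps)
    from DERIV_chain2[OF p'(2) this] show ?thesis by (simp add: Q_def)
  qed
  have cD: "continuous_on ({0<..} \<times> {0..1}) (\<lambda>(b, y). D b y)"
    using cm unfolding D_def case_prod_beta
    by (intro continuous_intros continuous_on_compose2[OF cp(2)[of UNIV]]) (auto dest: nz)
  have cQ: "continuous_on {0..1} (Q b)" if "0 < b" for b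
    using cm1[OF that] that unfolding Q_def
    by (intro continuous_intros continuous_on_compose2[OF cp(2)[of UNIV]]) (auto dest: nz)
  have "(F has_real_derivative 0) (at t within {0..})" if t: "0 \<le> t" for t
  proof -
    have \<alpha>: "(\<alpha> has_real_derivative 2 * j t * \<alpha> t) (at t within {0..})"
      unfolding \<alpha>_def by (auto intro!: derivative_eq_intros S[OF t])
    have pos: "0 < \<alpha> s" for s by (simp add: \<alpha>_def)
    have "(F has_real_derivative
        2 * j t * (\<integral>v. Q (\<alpha> t) (height e v) * (height e v * (1 - height e v)) \<partial>f t) +
        (2 * j t * \<alpha> t) * (\<integral>v. D (\<alpha> t) (height e v) \<partial>f t)) (at t within {0..})"
      unfolding F_def
      by (intro moving_test_function_derivative[OF sol e t, where G = "\<lambda>b y. p (mobius b y)" and D = D]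
          solution_height_derivative[OF sol e t J[OF t]] der_b der_y cD cQ \<alpha> pos
          continuous_on_compose2[OF cp(1)[of UNIV]] cm1) auto
    moreover have "(\<integral>v. Q (\<alpha> t) (height e v) * (height e v * (1 - height e v)) \<partial>f t) =
        (\<integral>v. - \<alpha> t * D (\<alpha> t) (height e v) \<partial>f t)"
      by (intro Bochner_Integration.integral_cong refl) (simp add: Q_def D_def)
    ultimately show ?thesis by simp
  qed
  then obtain c where c: "\<And>t. 0 \<le> t \<Longrightarrow> F t = c"
    using has_field_derivative_zero_constant[of "{0..}" F] by (auto simp: convex_real_interval)
  have "F T = F 0" using c T by simp
  moreover have "F T = (\<integral>v. p (height e v) \<partial>f T)" by (simp add: F_def \<alpha>_def mobius_def)
  moreover have "F 0 = (\<integral>v. p (mobius (exp (- 2 * S T)) (height e v)) \<partial>f0)"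
    using sol by (simp add: F_def \<alpha>_def S0 is_solution_def)
  ultimately show ?thesis by simp
qed

text \<open>The two distances need \<open>p y = sqrt (1 - y)\<close>, which is not differentiable at \<open>1\<close>; the Weierstrass
  theorem extends the identity from polynomials to all continuous functions.\<close>

lemma transport:
  fixes p :: "real \<Rightarrow> real"
  assumes sol: "is_solution f0 f" and e: "e \<in> unit_sphere"
    and J: "\<And>t. 0 \<le> t \<Longrightarrow> flux (f t) = j t *\<^sub>R e"
    and S: "\<And>t. 0 \<le> t \<Longrightarrow> (S has_real_derivative j t) (at t within {0..})" and S0: "S 0 = 0"
    and p: "continuous_on {0..1} p" and T: "0 \<le> T"
  shows "(\<integral>v. p (height e v) \<partial>f T) = (\<integral>v. p (mobius (exp (- 2 * S T)) (height e v)) \<partial>f0)"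
    (is "?L p = ?R p")
proof -
  let ?a = "exp (- 2 * S T)"
  have fT: "f T \<in> sphere_prob" and f0: "f0 \<in> sphere_prob"
    using sol T by (auto simp: is_solution_def)
  have cm: "continuous_on {0..1} (mobius ?a)"
    unfolding mobius_def by (intro continuous_intros) (use mobius_denom_pos[of ?a] in force)
  have cL: "continuous_on unit_sphere (\<lambda>v. q (height e v))" if "continuous_on {0..1} q" for q :: "real \<Rightarrow> real"
    by (rule continuous_on_compose2[OF that continuous_on_height]) (use height_bounds[OF e] in auto)
  have "continuous_on {0..1} (\<lambda>y. q (mobius ?a y))" if "continuous_on {0..1} q" for q :: "real \<Rightarrow> real"
    by (rule continuous_on_compose2[OF that cm]) (use mobius_bounds[of ?a] in auto)
  note cR = cL[OF this]
  have close: "\<bar>(\<integral>v. g v \<partial>\<mu>) - (\<integral>v. h v \<partial>\<mu>)\<bar> \<le> \<epsilon>"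
    if \<mu>: "\<mu> \<in> sphere_prob" and c: "continuous_on unit_sphere g" "continuous_on unit_sphere h"
      and le: "\<And>v. v \<in> unit_sphere \<Longrightarrow> \<bar>g v - h v\<bar> \<le> \<epsilon>" for g h :: "_ \<Rightarrow> real" and \<mu> \<epsilon>
  proof -
    interpret prob_space \<mu> using sphere_prob_space(3)[OF \<mu>] .
    note i = sphere_prob_integrable[OF \<mu> c(1)] sphere_prob_integrable[OF \<mu> c(2)]
    have "\<bar>(\<integral>v. g v \<partial>\<mu>) - (\<integral>v. h v \<partial>\<mu>)\<bar> = \<bar>\<integral>v. g v - h v \<partial>\<mu>\<bar>" using i by simp
    also have "\<dots> \<le> (\<integral>v. \<bar>g v - h v\<bar> \<partial>\<mu>)" by (rule integral_abs_bound)
    also have "\<dots> \<le> (\<integral>v. \<epsilon> \<partial>\<mu>)"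
      by (rule integral_mono) (use i le sphere_prob_space(1)[OF \<mu>] in simp_all)
    finally show ?thesis by (simp add: prob_space)
  qed
  have "\<bar>?L p - ?R p\<bar> \<le> \<epsilon>" if "0 < \<epsilon>" for \<epsilon>
  proof -
    obtain q where q: "real_polynomial_function q" "\<And>x. x \<in> {0..1} \<Longrightarrow> \<bar>p x - q x\<bar> < \<epsilon> / 2"
      using Stone_Weierstrass_real_polynomial_function[OF _ p, of "\<epsilon> / 2"] \<open>0 < \<epsilon>\<close> by auto
    have cq: "continuous_on {0..1} q"
      using q(1) by (auto intro: continuous_on_polymonial_function simp: real_polynomial_function_eq)
    have "\<bar>?L p - ?L q\<bar> \<le> \<epsilon> / 2"
      using height_bounds[OF e] by (intro close fT cL p cq less_imp_le[OF q(2)]) auto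
    moreover have "\<bar>?R p - ?R q\<bar> \<le> \<epsilon> / 2"
      using height_bounds[OF e] mobius_bounds[of ?a] by (intro close f0 cR p cq less_imp_le[OF q(2)]) auto
    moreover have "?L q = ?R q"
      by (rule transport_polynomial[OF sol e J S S0 q(1) T])
    ultimately show ?thesis by linarith
  qed
  then have "\<bar>?L p - ?R p\<bar> \<le> 0" by (rule field_le_epsilon) simp
  then show ?thesis by simp
qed

section \<open>The measure of spherical caps\<close>

lemma cap_in_sphere_borel: "{v \<in> unit_sphere. height e v \<le> r} \<in> sets sphere_borel"
proof -
  have "{v. height e v \<le> r} \<in> sets borel"
    unfolding height_def by measurable
  then show ?thesis
    by (auto simp: sets_restrict_space intro!: image_eqI[of _ _ "{v. height e v \<le> r}"])
qed

text \<open>Pythagoras: \<open>\<bar>y\<bar>\<^sup>2 - (y \<bullet> e)\<^sup>2\<close> is the squared distance of \<open>y\<close> to the axis through \<open>e\<close>.\<close>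

lemma norm_axis_decomposition:
  fixes e y :: "'a::euclidean_space"
  assumes "e \<in> unit_sphere"
  shows "(norm (y - c *\<^sub>R e))\<^sup>2 = ((norm y)\<^sup>2 - (y \<bullet> e)\<^sup>2) + (y \<bullet> e - c)\<^sup>2"
proof -
  have "e \<bullet> e = 1" using assms by (simp add: dot_square_norm)
  then show ?thesis
    by (simp add: power2_norm_eq_inner inner_diff_left inner_diff_right inner_commute[of e y])
      (simp add: power2_eq_square algebra_simps)
qed

text \<open>The cone over the cap lies in a tube of radius \<open>2 \<rho>\<close> around the segment from \<open>-e\<close> to \<open>e\<close>.
  Of order \<open>1 / \<rho>\<close> balls of radius \<open>3 \<rho>\<close> cover the tube, with total volume of order \<open>\<rho>\<^bsup>n - 1\<^esup>\<close>. Working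
  with balls avoids any choice of coordinates adapted to \<open>e\<close>.\<close>

lemma emeasure_cap_le:
  fixes e :: "'a::euclidean_space"
  assumes e: "e \<in> unit_sphere" and \<rho>: "0 < \<rho>" "\<rho> \<le> 1"
  shows "emeasure sphere_measure {v \<in> unit_sphere. height e v \<le> \<rho>\<^sup>2}
    \<le> ennreal (real DIM('a) * 6 * unit_ball_vol DIM('a) * 3 ^ DIM('a) * \<rho> ^ (DIM('a) - 1))"
proof -
  let ?A = "{v \<in> unit_sphere. height e v \<le> \<rho>\<^sup>2}"
  let ?V = "unit_ball_vol DIM('a)"
  define K where "K = \<lceil>1 / \<rho>\<rceil>"
  have K1: "1 \<le> K" using \<rho> by (simp add: K_def)
  have K: "1 / \<rho> \<le> K" "K * \<rho> \<le> 2"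
  proof -
    show "1 / \<rho> \<le> K" by (simp add: K_def)
    have "K \<le> 1 / \<rho> + 1" using ceiling_correct[of "1 / \<rho>"] by (simp add: K_def)
    then show "K * \<rho> \<le> 2" using mult_right_mono[of K "1 / \<rho> + 1" \<rho>] \<rho> by (simp add: algebra_simps)
  qed
  let ?B = "\<lambda>j::int. cball ((j * \<rho>) *\<^sub>R e) (3 * \<rho>)"
  have "{s *\<^sub>R v | s v. 0 < s \<and> s < 1 \<and> v \<in> ?A} \<subseteq> (\<Union>j\<in>{-K..K}. ?B j)"
  proof
    fix y assume "y \<in> {s *\<^sub>R v | s v. 0 < s \<and> s < 1 \<and> v \<in> ?A}"
    then obtain s v where y: "y = s *\<^sub>R v" "0 < s" "s < 1" and v: "v \<in> unit_sphere" "height e v \<le> \<rho>\<^sup>2"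
      by auto
    have h: "v \<bullet> e = 2 * height e v - 1" by (simp add: height_def field_simps)
    note hb = height_bounds[OF e v(1)]
    define j where "j = \<lfloor>(y \<bullet> e) / \<rho>\<rfloor>"
    have j: "j \<le> (y \<bullet> e) / \<rho>" "(y \<bullet> e) / \<rho> < j + 1" by (auto simp: j_def)
    then have j\<rho>: "j * \<rho> \<le> y \<bullet> e" "y \<bullet> e < j * \<rho> + \<rho>"
      using \<rho> by (auto simp: field_simps)
    have "\<bar>y \<bullet> e\<bar> \<le> 1"
      using Cauchy_Schwarz_ineq2[of y e] e y v by simp
    then have "\<bar>(y \<bullet> e) / \<rho>\<bar> \<le> K"
      using K(1) \<rho> by (simp add: abs_divide) (meson divide_right_mono less_eq_real_def order.trans)
    then have jK: "j \<in> {-K..K}"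
      unfolding j_def atLeastAtMost_iff le_floor_iff floor_le_iff by linarith
    have "(norm y)\<^sup>2 - (y \<bullet> e)\<^sup>2 = s\<^sup>2 * (4 * height e v * (1 - height e v))"
      using y v by (simp add: h power2_eq_square algebra_simps)
    also have "\<dots> \<le> 1 * (4 * \<rho>\<^sup>2 * 1)"
      using y v hb by (intro mult_mono power_le_one) auto
    finally have "(norm y)\<^sup>2 - (y \<bullet> e)\<^sup>2 \<le> 4 * \<rho>\<^sup>2" by simp
    moreover have "(y \<bullet> e - j * \<rho>)\<^sup>2 \<le> \<rho>\<^sup>2"
      using j\<rho> by (intro power_mono) auto
    ultimately have "(norm (y - (j * \<rho>) *\<^sub>R e))\<^sup>2 \<le> 9 * \<rho>\<^sup>2"
      unfolding norm_axis_decomposition[OF e] using zero_le_power2[of \<rho>] by linarith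
    then have "(norm (y - (j * \<rho>) *\<^sub>R e))\<^sup>2 \<le> (3 * \<rho>)\<^sup>2"
      by (simp add: power_mult_distrib)
    then have "norm (y - (j * \<rho>) *\<^sub>R e) \<le> 3 * \<rho>"
      by (rule power2_le_imp_le) (use \<rho> in simp)
    then have "y \<in> ?B j" by (simp add: dist_norm norm_minus_commute)
    then show "y \<in> (\<Union>j\<in>{-K..K}. ?B j)" using jK by blast
  qed
  then have "emeasure lborel {s *\<^sub>R v | s v. 0 < s \<and> s < 1 \<and> v \<in> ?A} \<le> emeasure lborel (\<Union>j\<in>{-K..K}. ?B j)"
    by (rule emeasure_mono) (auto intro!: sets.finite_UN)
  also have "\<dots> \<le> (\<Sum>j\<in>{-K..K}. emeasure lborel (?B j))"
    by (rule emeasure_subadditive_finite) auto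
  also have "\<dots> = ennreal (real (card {-K..K}) * (?V * (3 * \<rho>) ^ DIM('a)))"
    using \<rho> by (simp add: emeasure_cball ennreal_mult ennreal_of_nat_eq_real_of_nat)
  also have "real (card {-K..K}) = 2 * K + 1" using K1 by simp
  also have "ennreal ((2 * K + 1) * (?V * (3 * \<rho>) ^ DIM('a))) \<le> ennreal (6 * ?V * 3 ^ DIM('a) * \<rho> ^ (DIM('a) - 1))"
  proof (rule ennreal_leI)
    have "(2 * K + 1) * \<rho> \<le> 6" using K(2) K1 \<rho> by (simp add: algebra_simps)
    then have "(2 * K + 1) * \<rho> * (?V * 3 ^ DIM('a) * \<rho> ^ (DIM('a) - 1)) \<le> 6 * (?V * 3 ^ DIM('a) * \<rho> ^ (DIM('a) - 1))"
      using \<rho> by (intro mult_right_mono) auto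
    moreover have "(3 * \<rho>) ^ DIM('a) = 3 ^ DIM('a) * (\<rho> * \<rho> ^ (DIM('a) - 1))"
      by (simp add: power_mult_distrib power_eq_if[of \<rho> "DIM('a)"])
    ultimately show "(2 * K + 1) * (?V * (3 * \<rho>) ^ DIM('a)) \<le> 6 * ?V * 3 ^ DIM('a) * \<rho> ^ (DIM('a) - 1)"
      by (simp only: mult_ac)
  qed
  finally have le: "emeasure lborel {s *\<^sub>R v | s v. 0 < s \<and> s < 1 \<and> v \<in> ?A}
      \<le> ennreal (6 * ?V * 3 ^ DIM('a) * \<rho> ^ (DIM('a) - 1))" .
  have "emeasure sphere_measure ?A \<le> of_nat DIM('a) * ennreal (6 * ?V * 3 ^ DIM('a) * \<rho> ^ (DIM('a) - 1))"
    unfolding emeasure_sphere_measure[OF cap_in_sphere_borel] by (rule mult_left_mono[OF le]) simp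
  also have "\<dots> = ennreal (real DIM('a) * (6 * ?V * 3 ^ DIM('a) * \<rho> ^ (DIM('a) - 1)))"
    using \<rho> by (subst ennreal_mult) (simp_all add: ennreal_of_nat_eq_real_of_nat)
  finally show ?thesis by (simp only: mult_ac)
qed

text \<open>Points close to the negative half-axis are projected to points of small height: the numerator
  \<open>\<bar>y\<bar> + y \<bullet> e\<close> of the height is the quotient of the squared distance to the axis by
  \<open>\<bar>y\<bar> - y \<bullet> e \<ge> 1/4\<close>.\<close>

lemma height_normalized_near_axis:
  fixes e y :: "'a::euclidean_space"
  assumes e: "e \<in> unit_sphere" and neg: "y \<bullet> e \<le> - (1 / 8)"
  shows "height e (y /\<^sub>R norm y) \<le> 16 * ((norm y)\<^sup>2 - (y \<bullet> e)\<^sup>2)"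
proof -
  have le: "\<bar>y \<bullet> e\<bar> \<le> norm y" using Cauchy_Schwarz_ineq2[of y e] e by simp
  then have n: "1 / 8 \<le> norm y" using neg by linarith
  have "(norm y + y \<bullet> e) * (1 / 4) \<le> (norm y + y \<bullet> e) * (norm y - y \<bullet> e)"
    using le neg n by (intro mult_left_mono) auto
  also have "\<dots> = (norm y)\<^sup>2 - (y \<bullet> e)\<^sup>2" by (simp add: algebra_simps power2_eq_square)
  finally have d: "norm y + y \<bullet> e \<le> 4 * ((norm y)\<^sup>2 - (y \<bullet> e)\<^sup>2)" by simp
  have "height e (y /\<^sub>R norm y) = (norm y + y \<bullet> e) / (2 * norm y)"
  proof -
    have "y \<noteq> 0" using n by auto
    then show ?thesis by (simp add: height_def field_simps)
  qed
  also have "\<dots> \<le> (4 * ((norm y)\<^sup>2 - (y \<bullet> e)\<^sup>2)) / (1 / 4)"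
    using d n le by (intro frac_le) auto
  finally show ?thesis by simp
qed

text \<open>Dually to the covering of the upper bound, the cone over the cap contains of order \<open>1 / \<rho>\<close> disjoint
  balls of radius \<open>\<rho> / 8\<close> with centres on the axis, at distances from the origin between \<open>1/4\<close> and \<open>1/2\<close>.\<close>

lemma emeasure_cap_ge:
  fixes e :: "'a::euclidean_space"
  assumes e: "e \<in> unit_sphere" and \<rho>: "0 < \<rho>" "\<rho> \<le> 1"
  shows "ennreal (real DIM('a) * unit_ball_vol DIM('a) * (1 / 8) ^ DIM('a) * \<rho> ^ (DIM('a) - 1))
    \<le> emeasure sphere_measure {v \<in> unit_sphere. height e v \<le> \<rho>\<^sup>2}"
proof -
  let ?A = "{v \<in> unit_sphere. height e v \<le> \<rho>\<^sup>2}"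
  let ?C = "{s *\<^sub>R v | s v. 0 < s \<and> s < 1 \<and> v \<in> ?A}"
  let ?V = "unit_ball_vol DIM('a)"
  define K where "K = nat \<lfloor>1 / \<rho>\<rfloor>"
  have K: "K \<le> 1 / \<rho>" "1 / \<rho> \<le> real K + 1"
    using \<rho> floor_correct[of "1 / \<rho>"] by (simp_all add: K_def)
  define c where "c j = - (1 / 4) - real j * \<rho> / 4" for j
  let ?B = "\<lambda>j. ball (c j *\<^sub>R e) (\<rho> / 8)"
  have ne: "norm e = 1" using e by simp
  have c: "- (1 / 2) \<le> c j" "c j \<le> - (1 / 4)" if "j \<le> K" for j
  proof -
    have "real j \<le> 1 / \<rho>" using K(1) that by linarith
    then have "real j * \<rho> \<le> 1" using \<rho> by (simp add: field_simps)
    then show "- (1 / 2) \<le> c j" by (simp add: c_def)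
    show "c j \<le> - (1 / 4)" using \<rho> by (simp add: c_def)
  qed
  have sub: "?B j \<subseteq> ?C" if "j \<le> K" for j
  proof
    fix y assume "y \<in> ?B j"
    then have y: "norm (y - c j *\<^sub>R e) < \<rho> / 8" by (simp add: dist_norm norm_minus_commute)
    have "\<bar>y \<bullet> e - c j\<bar> = \<bar>(y - c j *\<^sub>R e) \<bullet> e\<bar>"
      using ne by (simp add: inner_diff_left dot_square_norm)
    also have "\<dots> \<le> norm (y - c j *\<^sub>R e)"
      using Cauchy_Schwarz_ineq2[of "y - c j *\<^sub>R e" e] ne by simp
    finally have ye: "y \<bullet> e \<le> - (1 / 8)"
      using y c[OF that] \<rho> by linarith
    have "norm y \<le> norm (y - c j *\<^sub>R e) + norm (c j *\<^sub>R e)"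
      using norm_triangle_ineq[of "y - c j *\<^sub>R e" "c j *\<^sub>R e"] by simp
    then have n1: "norm y < 1" using y c[OF that] \<rho> ne by simp
    have n0: "0 < norm y" using ye by (cases "y = 0") auto
    have "(norm y)\<^sup>2 - (y \<bullet> e)\<^sup>2 \<le> (norm (y - c j *\<^sub>R e))\<^sup>2"
      unfolding norm_axis_decomposition[OF e] by simp
    also have "\<dots> \<le> (\<rho> / 8)\<^sup>2" using y by (intro power_mono) auto
    also have "\<dots> \<le> \<rho>\<^sup>2 / 16" by (simp add: power_divide)
    finally have "16 * ((norm y)\<^sup>2 - (y \<bullet> e)\<^sup>2) \<le> \<rho>\<^sup>2" by simp
    then have "height e (y /\<^sub>R norm y) \<le> \<rho>\<^sup>2"
      using height_normalized_near_axis[OF e ye] by linarith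
    then have "y /\<^sub>R norm y \<in> ?A" using n0 by simp
    moreover have "y = norm y *\<^sub>R (y /\<^sub>R norm y)" using n0 by simp
    ultimately show "y \<in> ?C" using n0 n1 by blast
  qed
  have C: "?C \<in> sets borel"
  proof -
    have "?C = {y. 0 < norm y \<and> norm y < 1 \<and> height e (y /\<^sub>R norm y) \<le> \<rho>\<^sup>2}" (is "_ = ?D")
    proof
      show "?D \<subseteq> ?C"
      proof
        fix y assume y: "y \<in> ?D"
        then have "y = norm y *\<^sub>R (y /\<^sub>R norm y)" "y /\<^sub>R norm y \<in> ?A" by auto
        then show "y \<in> ?C" using y by blast
      qed
    qed auto
    also have "\<dots> \<in> sets borel" unfolding height_def by measurable
    finally show ?thesis .
  qed
  have disj: "disjoint_family_on ?B {..K}"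
    unfolding disjoint_family_on_def
  proof (intro ballI impI)
    fix i j :: nat assume "i \<noteq> j"
    then have "1 \<le> \<bar>real i - real j\<bar>" by linarith
    then have "1 * \<rho> \<le> \<bar>real i - real j\<bar> * \<rho>" using \<rho> by (intro mult_right_mono) auto
    also have "\<dots> = \<bar>(real i - real j) * \<rho>\<bar>" using \<rho> by (simp add: abs_mult)
    also have "(real i - real j) * \<rho> = - 4 * (c i - c j)" by (simp add: c_def algebra_simps)
    finally have "\<rho> / 4 \<le> \<bar>c i - c j\<bar>" unfolding abs_mult by simp
    also have "\<bar>c i - c j\<bar> = dist (c i *\<^sub>R e) (c j *\<^sub>R e)"
      using ne by (simp add: dist_norm scaleR_diff_left[symmetric])
    finally show "?B i \<inter> ?B j = {}"
      by (intro disjoint_ballI) simp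
  qed
  have "ennreal (?V * (1 / 8) ^ DIM('a) * \<rho> ^ (DIM('a) - 1)) \<le> ennreal ((real K + 1) * (?V * (\<rho> / 8) ^ DIM('a)))"
  proof (rule ennreal_leI)
    have "1 \<le> (real K + 1) * \<rho>" using K(2) \<rho> by (simp add: field_simps)
    then have "1 * (?V * (1 / 8) ^ DIM('a) * \<rho> ^ (DIM('a) - 1)) \<le> (real K + 1) * \<rho> * (?V * (1 / 8) ^ DIM('a) * \<rho> ^ (DIM('a) - 1))"
      using \<rho> by (intro mult_right_mono) auto
    moreover have "(\<rho> / 8) ^ DIM('a) = (1 / 8) ^ DIM('a) * (\<rho> * \<rho> ^ (DIM('a) - 1))"
      by (simp add: power_divide power_eq_if[of \<rho> "DIM('a)"])
    ultimately show "?V * (1 / 8) ^ DIM('a) * \<rho> ^ (DIM('a) - 1) \<le> (real K + 1) * (?V * (\<rho> / 8) ^ DIM('a))"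
      by (simp only: mult_ac mult_1)
  qed
  also have "\<dots> = (\<Sum>j\<in>{..K}. emeasure lborel (?B j))"
  proof -
    have "(\<Sum>j\<in>{..K}. emeasure lborel (?B j)) = (\<Sum>j\<in>{..K}. ennreal (?V * (\<rho> / 8) ^ DIM('a)))"
      using \<rho> by (intro sum.cong refl emeasure_ball) simp
    also have "\<dots> = ennreal (\<Sum>j\<in>{..K}. ?V * (\<rho> / 8) ^ DIM('a))"
      using \<rho> by (intro sum_ennreal) simp
    finally show ?thesis by (simp add: add.commute)
  qed
  also have "\<dots> = emeasure lborel (\<Union>j\<in>{..K}. ?B j)"
    by (rule sum_emeasure[OF _ disj]) auto
  also have "\<dots> \<le> emeasure lborel ?C"
    using C by (intro emeasure_mono UN_least sub) auto
  finally have le: "ennreal (?V * (1 / 8) ^ DIM('a) * \<rho> ^ (DIM('a) - 1)) \<le> emeasure lborel ?C" .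
  have "ennreal (real DIM('a) * (?V * (1 / 8) ^ DIM('a) * \<rho> ^ (DIM('a) - 1))) =
      of_nat DIM('a) * ennreal (?V * (1 / 8) ^ DIM('a) * \<rho> ^ (DIM('a) - 1))"
    using \<rho> by (subst ennreal_mult) (simp_all add: ennreal_of_nat_eq_real_of_nat)
  also have "\<dots> \<le> emeasure sphere_measure ?A"
    unfolding emeasure_sphere_measure[OF cap_in_sphere_borel] by (rule mult_left_mono[OF le]) simp
  finally show ?thesis by (simp only: mult_ac)
qed

text \<open>Both bounds with \<open>\<rho> = sqrt r\<close>; this is where the exponent \<open>(n - 1) / 2\<close> comes from.\<close>

lemma emeasure_cap_powr:
  fixes e :: "'a::euclidean_space"
  assumes e: "e \<in> unit_sphere"
  defines "\<alpha> \<equiv> (real DIM('a) - 1) / 2"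
  obtains c C where "0 < c" "0 < C"
    "\<And>r. 0 < r \<Longrightarrow> r \<le> 1 \<Longrightarrow> ennreal (c * r powr \<alpha>) \<le> emeasure sphere_measure {v \<in> unit_sphere. height e v \<le> r}"
    "\<And>r. 0 < r \<Longrightarrow> r \<le> 1 \<Longrightarrow> emeasure sphere_measure {v \<in> unit_sphere. height e v \<le> r} \<le> ennreal (C * r powr \<alpha>)"
proof
  let ?n = "DIM('a)"
  have p: "sqrt r ^ (?n - 1) = r powr \<alpha>" "0 < sqrt r" "sqrt r \<le> 1" "(sqrt r)\<^sup>2 = r" if "0 < r" "r \<le> 1" for r
  proof -
    have "sqrt r ^ (?n - 1) = sqrt r powr real (?n - 1)"
      by (rule powr_realpow[symmetric]) (use that in simp)
    also have "\<dots> = r powr \<alpha>"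
      using that by (simp add: powr_half_sqrt[symmetric] powr_powr \<alpha>_def of_nat_diff Suc_leI)
    finally show "sqrt r ^ (?n - 1) = r powr \<alpha>" .
  qed (use that in auto)
  show "0 < real ?n * unit_ball_vol ?n * (1 / 8) ^ ?n" "0 < real ?n * 6 * unit_ball_vol ?n * 3 ^ ?n"
    by simp_all
  show "ennreal (real ?n * unit_ball_vol ?n * (1 / 8) ^ ?n * r powr \<alpha>)
      \<le> emeasure sphere_measure {v \<in> unit_sphere. height e v \<le> r}" if "0 < r" "r \<le> 1" for r
    using emeasure_cap_ge[OF e p(2,3)[OF that]] p[OF that] by simp
  show "emeasure sphere_measure {v \<in> unit_sphere. height e v \<le> r}
      \<le> ennreal (real ?n * 6 * unit_ball_vol ?n * 3 ^ ?n * r powr \<alpha>)" if "0 < r" "r \<le> 1" for r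
    using emeasure_cap_le[OF e p(2,3)[OF that]] p[OF that] by simp
qed

lemma density_cap_bounds:
  fixes e :: "'a::euclidean_space"
  assumes e: "e \<in> unit_sphere" and \<rho>: "\<rho> \<in> borel_measurable sphere_borel"
    and \<mu>_def: "\<mu> = density sphere_measure (\<lambda>v. ennreal (\<rho> v))"
    and m: "0 < m" "\<And>v. v \<in> unit_sphere \<Longrightarrow> m \<le> \<rho> v \<and> \<rho> v \<le> M"
  defines "\<alpha> \<equiv> (real DIM('a) - 1) / 2"
  obtains c C where "0 < c" "0 < C"
    "\<And>r. 0 < r \<Longrightarrow> r \<le> 1 \<Longrightarrow> ennreal (c * r powr \<alpha>) \<le> emeasure \<mu> {v \<in> unit_sphere. height e v \<le> r}"
    "\<And>r. 0 < r \<Longrightarrow> r \<le> 1 \<Longrightarrow> emeasure \<mu> {v \<in> unit_sphere. height e v \<le> r} \<le> ennreal (C * r powr \<alpha>)"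
proof -
  obtain c C where c: "0 < c" "0 < C"
    "\<And>r. 0 < r \<Longrightarrow> r \<le> 1 \<Longrightarrow> ennreal (c * r powr \<alpha>) \<le> emeasure sphere_measure {v \<in> unit_sphere. height e v \<le> r}"
    "\<And>r. 0 < r \<Longrightarrow> r \<le> 1 \<Longrightarrow> emeasure sphere_measure {v \<in> unit_sphere. height e v \<le> r} \<le> ennreal (C * r powr \<alpha>)"
    by (rule emeasure_cap_powr[OF e, folded \<alpha>_def]) blast
  have M: "0 < M" using m e by (meson less_le_trans)
  have sets: "sets sphere_measure = sets (sphere_borel :: 'a measure)" by (simp add: sphere_measure_def)
  have space: "space sphere_measure = (unit_sphere :: 'a set)"
    using sets_eq_imp_space_eq[OF sets] by (simp add: space_restrict_space)
  have \<rho>': "(\<lambda>v. ennreal (\<rho> v)) \<in> borel_measurable sphere_measure"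
    using \<rho> by (simp cong: measurable_cong_sets add: sets)
  show ?thesis
  proof
    show "0 < m * c" "0 < M * C" using m M c by auto
    fix r :: real assume r: "0 < r" "r \<le> 1"
    let ?A = "{v \<in> unit_sphere. height e v \<le> r}"
    have A: "?A \<in> sets sphere_measure" using cap_in_sphere_borel by (simp add: sets)
    have E: "emeasure \<mu> ?A = (\<integral>\<^sup>+v. ennreal (\<rho> v) * indicator ?A v \<partial>sphere_measure)"
      unfolding \<mu>_def by (rule emeasure_density[OF \<rho>' A])
    have "ennreal (m * c * r powr \<alpha>) = ennreal m * ennreal (c * r powr \<alpha>)"
      using m c by (simp add: ennreal_mult[symmetric] mult.assoc)
    also have "\<dots> \<le> ennreal m * emeasure sphere_measure ?A"
      by (intro mult_left_mono c r) simp
    also have "\<dots> = (\<integral>\<^sup>+v. ennreal m * indicator ?A v \<partial>sphere_measure)"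
      using A by (simp add: nn_integral_cmult_indicator)
    also have "\<dots> \<le> emeasure \<mu> ?A"
      unfolding E by (intro nn_integral_mono) (use m in \<open>auto simp: indicator_def intro: ennreal_leI\<close>)
    finally show "ennreal (m * c * r powr \<alpha>) \<le> emeasure \<mu> ?A" .
    have "emeasure \<mu> ?A \<le> (\<integral>\<^sup>+v. ennreal M * indicator ?A v \<partial>sphere_measure)"
      unfolding E by (intro nn_integral_mono) (use m in \<open>auto simp: indicator_def intro: ennreal_leI\<close>)
    also have "\<dots> = ennreal M * emeasure sphere_measure ?A"
      using A by (simp add: nn_integral_cmult_indicator)
    also have "\<dots> \<le> ennreal M * ennreal (C * r powr \<alpha>)"
      by (intro mult_left_mono c r) simp
    also have "\<dots> = ennreal (M * C * r powr \<alpha>)"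
      using M c by (simp add: ennreal_mult[symmetric] mult.assoc)
    finally show "emeasure \<mu> ?A \<le> ennreal (M * C * r powr \<alpha>)" .
  qed
qed

section \<open>Layer-cake integration against a power law\<close>

text \<open>The integral of \<open>r\<^bsup>\<gamma> - 1\<^esup>\<close> over \<open>[a, 1]\<close>.\<close>

definition power_integral :: "real \<Rightarrow> real \<Rightarrow> real" where
  "power_integral \<gamma> a = (if \<gamma> = 0 then - ln a else (1 - a powr \<gamma>) / \<gamma>)"

lemma nn_integral_power_integral:
  assumes "0 < a" "a \<le> 1"
  shows "(\<integral>\<^sup>+r. ennreal (r powr (\<gamma> - 1)) * indicator {a..1} r \<partial>lborel) = ennreal (power_integral \<gamma> a)"
proof -
  define F where "F r = (if \<gamma> = 0 then ln r else r powr \<gamma> / \<gamma>)" for r :: real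
  have d: "DERIV F r :> r powr (\<gamma> - 1)" if "a \<le> r" for r
  proof (cases "\<gamma> = 0")
    case True
    then show ?thesis
      using that assms DERIV_ln[of r] by (simp add: F_def[abs_def] powr_minus)
  next
    case False
    then show ?thesis
      using that assms DERIV_cdivide[OF has_real_derivative_powr[of r \<gamma>], of \<gamma>] by (simp add: F_def[abs_def])
  qed
  have "(\<integral>\<^sup>+r. ennreal (r powr (\<gamma> - 1)) * indicator {a..1} r \<partial>lborel) = ennreal (F 1 - F a)"
    using assms by (intro nn_integral_FTC_Icc) (auto intro: has_field_derivative_at_within d)
  then show ?thesis
    using assms by (simp add: F_def power_integral_def diff_divide_distrib)
qed

lemma power_integral_nonneg: "0 < a \<Longrightarrow> a \<le> 1 \<Longrightarrow> 0 \<le> power_integral \<gamma> a"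
  using powr_mono'[of 0 \<gamma> a] powr_mono'[of \<gamma> 0 a]
  by (cases "\<gamma> < 0") (auto simp: power_integral_def intro: divide_nonpos_neg)

text \<open>The function \<open>(a / max a u)\<^sup>\<beta>\<close>, which is \<open>min 1 (a / u)\<^sup>\<beta>\<close> for positive \<open>u\<close> and equals \<open>1\<close> at \<open>u = 0\<close>, is
  decreasing in \<open>u\<close>. It is therefore a mixture of the indicators of \<open>u \<le> r\<close>, with its derivative as weight.\<close>

lemma layer_cake_pointwise:
  assumes a: "0 < a" "a \<le> 1" and \<beta>: "0 < \<beta>" and u: "u \<le> 1"
  shows "ennreal ((a / max a u) powr \<beta>) =
    ennreal (a powr \<beta>) +
    (\<integral>\<^sup>+r. ennreal (\<beta> * a powr \<beta> * r powr (- \<beta> - 1)) * indicator {a..1} r * indicator {u..} r \<partial>lborel)"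
proof -
  let ?b = "max a u"
  have b: "0 < ?b" "?b \<le> 1" using a u by auto
  have d: "DERIV (\<lambda>r. - (a powr \<beta>) * r powr (- \<beta>)) r :> \<beta> * a powr \<beta> * r powr (- \<beta> - 1)"
    if "?b \<le> r" for r
    using DERIV_cmult[OF has_real_derivative_powr[of r "- \<beta>"], of "- (a powr \<beta>)"] that b
    by (simp add: algebra_simps)
  have "(\<integral>\<^sup>+r. ennreal (\<beta> * a powr \<beta> * r powr (- \<beta> - 1)) * indicator {a..1} r * indicator {u..} r \<partial>lborel)
      = (\<integral>\<^sup>+r. ennreal (\<beta> * a powr \<beta> * r powr (- \<beta> - 1)) * indicator {?b..1} r \<partial>lborel)"
    by (intro nn_integral_cong) (auto simp: indicator_def)
  also have "\<dots> = ennreal (- (a powr \<beta>) * 1 powr (- \<beta>) - (- (a powr \<beta>) * ?b powr (- \<beta>)))"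
    using \<beta> b by (intro nn_integral_FTC_Icc) (auto intro: has_field_derivative_at_within d[unfolded mult_minus_left])
  also have "\<dots> = ennreal ((a / ?b) powr \<beta> - a powr \<beta>)"
    using a b by (simp add: powr_divide powr_minus field_simps)
  finally have *: "(\<integral>\<^sup>+r. ennreal (\<beta> * a powr \<beta> * r powr (- \<beta> - 1)) * indicator {a..1} r * indicator {u..} r \<partial>lborel)
     = ennreal ((a / ?b) powr \<beta> - a powr \<beta>)" .
  have "a \<le> a / ?b" using a b by (simp add: field_simps)
  then have "a powr \<beta> \<le> (a / ?b) powr \<beta>"
    using a \<beta> by (intro powr_mono2) auto
  then show ?thesis
    unfolding * by (subst ennreal_plus[symmetric]) auto
qed

text \<open>Tonelli's theorem turns the pointwise mixture into an integral of the masses of the sublevel sets.\<close>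

lemma layer_cake:
  assumes N: "finite_measure N" and u [measurable]: "u \<in> borel_measurable N"
    and u1: "\<And>x. x \<in> space N \<Longrightarrow> u x \<le> 1"
    and a: "0 < a" "a \<le> 1" and \<beta>: "0 < \<beta>"
  shows "(\<integral>\<^sup>+x. ennreal ((a / max a (u x)) powr \<beta>) \<partial>N) =
    ennreal (a powr \<beta>) * emeasure N (space N) +
    (\<integral>\<^sup>+r. ennreal (\<beta> * a powr \<beta> * r powr (- \<beta> - 1)) * indicator {a..1} r *
       emeasure N {x \<in> space N. u x \<le> r} \<partial>lborel)"
proof -
  interpret finite_measure N by fact
  interpret pair_sigma_finite N lborel ..
  let ?k = "\<lambda>r::real. ennreal (\<beta> * a powr \<beta> * r powr (- \<beta> - 1)) * indicator {a..1} r"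
  have m: "(\<lambda>(x, r). ?k r * indicator {u x..} r) \<in> borel_measurable (N \<Otimes>\<^sub>M lborel)"
  proof -
    have "(\<lambda>(x, r). ?k r * indicator {u x..} r) = (\<lambda>p. ?k (snd p) * (if u (fst p) \<le> snd p then 1 else 0))"
      by (auto simp: indicator_def fun_eq_iff)
    also have "\<dots> \<in> borel_measurable (N \<Otimes>\<^sub>M lborel)"
      by measurable
    finally show ?thesis .
  qed
  have "(\<integral>\<^sup>+x. ennreal ((a / max a (u x)) powr \<beta>) \<partial>N) =
      (\<integral>\<^sup>+x. ennreal (a powr \<beta>) + (\<integral>\<^sup>+r. ?k r * indicator {u x..} r \<partial>lborel) \<partial>N)"
    by (intro nn_integral_cong layer_cake_pointwise a \<beta> u1)
  also have "\<dots> = ennreal (a powr \<beta>) * emeasure N (space N) +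
      (\<integral>\<^sup>+x. (\<integral>\<^sup>+r. ?k r * indicator {u x..} r \<partial>lborel) \<partial>N)"
    by (subst nn_integral_add[OF _ lborel.borel_measurable_nn_integral[OF m]]) simp_all
  also have "(\<integral>\<^sup>+x. (\<integral>\<^sup>+r. ?k r * indicator {u x..} r \<partial>lborel) \<partial>N) =
      (\<integral>\<^sup>+r. (\<integral>\<^sup>+x. ?k r * indicator {u x..} r \<partial>N) \<partial>lborel)"
    by (rule Fubini'[OF m, symmetric])
  also have "\<dots> = (\<integral>\<^sup>+r. ?k r * emeasure N {x \<in> space N. u x \<le> r} \<partial>lborel)"
  proof (intro nn_integral_cong)
    fix r :: real
    have "(\<integral>\<^sup>+x. ?k r * indicator {u x..} r \<partial>N) = (\<integral>\<^sup>+x. ?k r * indicator {x \<in> space N. u x \<le> r} x \<partial>N)"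
      by (intro nn_integral_cong) (auto simp: indicator_def)
    then show "(\<integral>\<^sup>+x. ?k r * indicator {u x..} r \<partial>N) = ?k r * emeasure N {x \<in> space N. u x \<le> r}"
      by (simp add: nn_integral_cmult_indicator)
  qed
  finally show ?thesis .
qed

lemma layer_cake_power:
  assumes "0 < a" "a \<le> 1" "0 < \<beta>" "0 \<le> c"
  shows "(\<integral>\<^sup>+r. ennreal (\<beta> * a powr \<beta> * r powr (- \<beta> - 1)) * indicator {a..1} r *
       ennreal (c * r powr \<alpha>) \<partial>lborel) = ennreal (\<beta> * c * a powr \<beta> * power_integral (\<alpha> - \<beta>) a)"
proof -
  have "(\<integral>\<^sup>+r. ennreal (\<beta> * a powr \<beta> * r powr (- \<beta> - 1)) * indicator {a..1} r *
       ennreal (c * r powr \<alpha>) \<partial>lborel) =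
     (\<integral>\<^sup>+r. ennreal (\<beta> * c * a powr \<beta>) * (ennreal (r powr ((\<alpha> - \<beta>) - 1)) * indicator {a..1} r) \<partial>lborel)"
  proof (intro nn_integral_cong)
    fix r :: real
    have "\<beta> * a powr \<beta> * r powr (- \<beta> - 1) * (c * r powr \<alpha>) = \<beta> * c * a powr \<beta> * r powr ((\<alpha> - \<beta>) - 1)"
    proof -
      have "r powr (- \<beta> - 1) * r powr \<alpha> = r powr ((\<alpha> - \<beta>) - 1)"
        unfolding powr_add[symmetric] by (rule arg_cong[where f = "(powr) r"]) simp
      then show ?thesis by (simp only: mult_ac)
    qed
    then have "ennreal (\<beta> * a powr \<beta> * r powr (- \<beta> - 1)) * ennreal (c * r powr \<alpha>) =
        ennreal (\<beta> * c * a powr \<beta>) * ennreal (r powr ((\<alpha> - \<beta>) - 1))"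
      using assms by (simp add: ennreal_mult[symmetric])
    then show "ennreal (\<beta> * a powr \<beta> * r powr (- \<beta> - 1)) * indicator {a..1} r * ennreal (c * r powr \<alpha>) =
        ennreal (\<beta> * c * a powr \<beta>) * (ennreal (r powr ((\<alpha> - \<beta>) - 1)) * indicator {a..1} r)"
      by (auto simp: indicator_def)
  qed
  also have "\<dots> = ennreal (\<beta> * c * a powr \<beta>) * ennreal (power_integral (\<alpha> - \<beta>) a)"
    using assms by (subst nn_integral_cmult) (auto simp: nn_integral_power_integral)
  finally show ?thesis
    using assms power_integral_nonneg[of a "\<alpha> - \<beta>"] by (simp add: ennreal_mult[symmetric])
qed

lemma layer_cake_upper:
  assumes N: "finite_measure N" and u: "u \<in> borel_measurable N"
    and u1: "\<And>x. x \<in> space N \<Longrightarrow> u x \<le> 1"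
    and a: "0 < a" "a \<le> 1" and \<beta>: "0 < \<beta>" and C: "0 \<le> C"
    and le: "\<And>r. 0 < r \<Longrightarrow> r \<le> 1 \<Longrightarrow> emeasure N {x \<in> space N. u x \<le> r} \<le> ennreal (C * r powr \<alpha>)"
  shows "(\<integral>\<^sup>+x. ennreal ((a / max a (u x)) powr \<beta>) \<partial>N) \<le>
    ennreal (a powr \<beta>) * emeasure N (space N) + ennreal (\<beta> * C * a powr \<beta> * power_integral (\<alpha> - \<beta>) a)"
proof -
  have "(\<integral>\<^sup>+x. ennreal ((a / max a (u x)) powr \<beta>) \<partial>N) =
    ennreal (a powr \<beta>) * emeasure N (space N) +
    (\<integral>\<^sup>+r. ennreal (\<beta> * a powr \<beta> * r powr (- \<beta> - 1)) * indicator {a..1} r *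
       emeasure N {x \<in> space N. u x \<le> r} \<partial>lborel)"
    by (intro layer_cake N u u1 a \<beta>)
  also have "\<dots> \<le> ennreal (a powr \<beta>) * emeasure N (space N) +
    (\<integral>\<^sup>+r. ennreal (\<beta> * a powr \<beta> * r powr (- \<beta> - 1)) * indicator {a..1} r * ennreal (C * r powr \<alpha>) \<partial>lborel)"
    using a by (intro add_left_mono nn_integral_mono) (auto simp: indicator_def intro!: mult_left_mono le)
  finally show ?thesis
    by (simp only: layer_cake_power[OF a \<beta> C])
qed

lemma layer_cake_lower:
  assumes N: "finite_measure N" and u: "u \<in> borel_measurable N"
    and u1: "\<And>x. x \<in> space N \<Longrightarrow> u x \<le> 1"
    and a: "0 < a" "a \<le> 1" and \<beta>: "0 < \<beta>" and c: "0 \<le> c"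
    and ge: "\<And>r. 0 < r \<Longrightarrow> r \<le> 1 \<Longrightarrow> ennreal (c * r powr \<alpha>) \<le> emeasure N {x \<in> space N. u x \<le> r}"
  shows "ennreal (a powr \<beta>) * emeasure N (space N) + ennreal (\<beta> * c * a powr \<beta> * power_integral (\<alpha> - \<beta>) a)
    \<le> (\<integral>\<^sup>+x. ennreal ((a / max a (u x)) powr \<beta>) \<partial>N)"
proof -
  have "ennreal (a powr \<beta>) * emeasure N (space N) +
    (\<integral>\<^sup>+r. ennreal (\<beta> * a powr \<beta> * r powr (- \<beta> - 1)) * indicator {a..1} r * ennreal (c * r powr \<alpha>) \<partial>lborel)
    \<le> ennreal (a powr \<beta>) * emeasure N (space N) +
    (\<integral>\<^sup>+r. ennreal (\<beta> * a powr \<beta> * r powr (- \<beta> - 1)) * indicator {a..1} r *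
       emeasure N {x \<in> space N. u x \<le> r} \<partial>lborel)"
    using a by (intro add_left_mono nn_integral_mono) (auto simp: indicator_def intro!: mult_left_mono ge)
  also have "\<dots> = (\<integral>\<^sup>+x. ennreal ((a / max a (u x)) powr \<beta>) \<partial>N)"
    by (intro layer_cake[symmetric] N u u1 a \<beta>)
  finally show ?thesis
    by (simp only: layer_cake_power[OF a \<beta> c])
qed

section \<open>The distance defect of the transported measure\<close>

text \<open>The quotient \<open>a (1 - y) / (y + a (1 - y))\<close> vanishes at \<open>y = 1\<close>, so it is comparable with
  \<open>min 1 (a / y)\<close> only away from \<open>1\<close>.\<close>

lemma one_minus_mobius:
  assumes a: "0 < a" "a \<le> 1" and y: "0 \<le> y" "y \<le> 1"
  shows "1 - mobius a y \<le> a / max a y"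
    and "y \<le> 1 / 2 \<Longrightarrow> (a / max a y) / 4 \<le> 1 - mobius a y"
proof -
  have d: "0 < y + a * (1 - y)" using mobius_denom_pos a y by simp
  have eq: "1 - mobius a y = a * (1 - y) / (y + a * (1 - y))"
    using d by (simp add: mobius_def field_simps)
  have m: "0 < max a y" using a by simp
  have ay: "0 \<le> a * y" "a * y \<le> a" "a * y \<le> y" using a y by (auto intro: mult_left_le mult_left_le_one_le)
  have "a * (1 - y) * max a y \<le> a * (y + a * (1 - y))"
  proof (cases "a \<le> y")
    case True
    have "(1 - y) * y \<le> y" using y by (simp add: mult_left_le_one_le)
    moreover have "0 \<le> a * (1 - y)" using a y by simp
    ultimately have "(1 - y) * y \<le> y + a * (1 - y)" by linarith
    then show ?thesis using a True by (simp add: max_def mult.assoc)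
  next
    case False
    then show ?thesis using a y by (simp add: max_def algebra_simps)
  qed
  then show "1 - mobius a y \<le> a / max a y"
    unfolding eq using d m by (simp add: pos_divide_le_eq pos_le_divide_eq)
  assume "y \<le> 1 / 2"
  then have "a * (1 / 2) / (2 * max a y) \<le> a * (1 - y) / (y + a * (1 - y))"
    using a y d ay by (intro frac_le mult_left_mono) (auto simp: algebra_simps)
  then show "(a / max a y) / 4 \<le> 1 - mobius a y"
    unfolding eq by simp
qed

lemma defect_integrable:
  assumes N: "prob_space N" and u [measurable]: "u \<in> borel_measurable N"
    and u01: "\<And>x. x \<in> space N \<Longrightarrow> 0 \<le> u x \<and> u x \<le> 1" and a: "0 < a" and \<beta>: "0 < \<beta>"
  shows "integrable N (\<lambda>x. (1 - mobius a (u x)) powr \<beta>)"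
proof -
  interpret prob_space N by fact
  have "(1 - mobius a (u x)) powr \<beta> \<le> 1" if "x \<in> space N" for x
    using mobius_bounds[OF a, of "u x"] u01[OF that] \<beta> by (intro powr_le1) auto
  then show ?thesis
    unfolding mobius_def by (intro integrable_const_bound[where B = 1]) auto
qed

lemma defect_integral_le:
  assumes N: "prob_space N" and u: "u \<in> borel_measurable N"
    and u01: "\<And>x. x \<in> space N \<Longrightarrow> 0 \<le> u x \<and> u x \<le> 1"
    and a: "0 < a" "a \<le> 1" and \<beta>: "0 < \<beta>" and C: "0 \<le> C"
    and le: "\<And>r. 0 < r \<Longrightarrow> r \<le> 1 \<Longrightarrow> emeasure N {x \<in> space N. u x \<le> r} \<le> ennreal (C * r powr \<alpha>)"
  shows "(\<integral>x. (1 - mobius a (u x)) powr \<beta> \<partial>N) \<le> a powr \<beta> * (1 + \<beta> * C * power_integral (\<alpha> - \<beta>) a)"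
proof -
  interpret prob_space N by fact
  let ?P = "power_integral (\<alpha> - \<beta>) a"
  have P: "0 \<le> ?P" using a by (rule power_integral_nonneg)
  have "ennreal (\<integral>x. (1 - mobius a (u x)) powr \<beta> \<partial>N) = (\<integral>\<^sup>+x. ennreal ((1 - mobius a (u x)) powr \<beta>) \<partial>N)"
    by (rule nn_integral_eq_integral[symmetric, OF defect_integrable[OF N u u01 a(1) \<beta>]]) auto
  also have "\<dots> \<le> (\<integral>\<^sup>+x. ennreal ((a / max a (u x)) powr \<beta>) \<partial>N)"
  proof (intro nn_integral_mono ennreal_leI powr_mono2)
    fix x assume "x \<in> space N"
    then show "1 - mobius a (u x) \<le> a / max a (u x)" "0 \<le> 1 - mobius a (u x)"
      using one_minus_mobius(1)[OF a, of "u x"] mobius_bounds[OF a(1), of "u x"] u01 by auto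
  qed (use \<beta> in simp)
  also have "\<dots> \<le> ennreal (a powr \<beta>) * emeasure N (space N) + ennreal (\<beta> * C * a powr \<beta> * ?P)"
    using u01 by (intro layer_cake_upper[OF _ u _ a \<beta> C le]) (auto intro: finite_measure_axioms)
  also have "\<dots> = ennreal (a powr \<beta> * (1 + \<beta> * C * ?P))"
    using P \<beta> C by (simp add: emeasure_space_1 ennreal_plus[symmetric] algebra_simps del: ennreal_plus)
  finally show ?thesis
    using P \<beta> C by (subst (asm) ennreal_le_iff) auto
qed

text \<open>The comparison with \<open>min 1 (a / u)\<close> is available for \<open>u \<le> 1/2\<close>, so the layer-cake formula is applied to
  the measure restricted to this set. The restriction keeps the power law from below, at the price of
  replacing \<open>r\<close> by \<open>r / 2\<close>.\<close>

lemma defect_integral_ge: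
  assumes N: "prob_space N" and u [measurable]: "u \<in> borel_measurable N"
    and u01: "\<And>x. x \<in> space N \<Longrightarrow> 0 \<le> u x \<and> u x \<le> 1"
    and a: "0 < a" "a \<le> 1" and \<beta>: "0 < \<beta>" and c: "0 \<le> c"
    and ge: "\<And>r. 0 < r \<Longrightarrow> r \<le> 1 \<Longrightarrow> ennreal (c * r powr \<alpha>) \<le> emeasure N {x \<in> space N. u x \<le> r}"
  shows "(1 / 4) powr \<beta> * (c * (1 / 2) powr \<alpha>) * (a powr \<beta> * (1 + \<beta> * power_integral (\<alpha> - \<beta>) a))
    \<le> (\<integral>x. (1 - mobius a (u x)) powr \<beta> \<partial>N)"
proof -
  interpret prob_space N by fact
  let ?P = "power_integral (\<alpha> - \<beta>) a"
  let ?c = "c * (1 / 2) powr \<alpha>"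
  let ?H = "{x \<in> space N. u x \<le> 1 / 2}"
  define N' where "N' = density N (indicator ?H)"
  have P: "0 \<le> ?P" using a by (rule power_integral_nonneg)
  have H [measurable]: "?H \<in> sets N" by measurable
  have sp: "space N' = space N" by (simp add: N'_def)
  have fin: "finite_measure N'"
    unfolding N'_def using emeasure_finite
    by (intro finite_measureI) (simp add: emeasure_density nn_integral_indicator flip: indicator_inter_arith cong: nn_integral_cong)
  have low: "ennreal (?c * r powr \<alpha>) \<le> emeasure N' {x \<in> space N'. u x \<le> r}" if r: "0 < r" "r \<le> 1" for r
  proof -
    have "ennreal (?c * r powr \<alpha>) = ennreal (c * (r / 2) powr \<alpha>)"
      using r powr_mult[of "1 / 2" r \<alpha>] by (simp add: mult.assoc)
    also have "\<dots> \<le> emeasure N {x \<in> space N. u x \<le> r / 2}" using r by (intro ge) auto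
    also have "\<dots> \<le> emeasure N (?H \<inter> {x \<in> space N. u x \<le> r})"
      using r by (intro emeasure_mono) auto
    also have "\<dots> = emeasure N' {x \<in> space N'. u x \<le> r}"
      by (simp add: N'_def emeasure_density flip: indicator_inter_arith)
    finally show ?thesis .
  qed
  have one: "ennreal ?c \<le> emeasure N' (space N')"
  proof -
    have "ennreal ?c \<le> emeasure N' {x \<in> space N'. u x \<le> 1}" using low[of 1] by simp
    also have "{x \<in> space N'. u x \<le> 1} = space N'" using u01 by (auto simp: sp)
    finally show ?thesis .
  qed
  have "ennreal ((1 / 4) powr \<beta> * ?c * (a powr \<beta> * (1 + \<beta> * ?P))) =
      ennreal ((1 / 4) powr \<beta>) * (ennreal (a powr \<beta>) * ennreal ?c + ennreal (\<beta> * ?c * a powr \<beta> * ?P))"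
    using P \<beta> c by (simp add: ennreal_mult[symmetric] ennreal_plus[symmetric] algebra_simps del: ennreal_plus)
  also have "\<dots> \<le> ennreal ((1 / 4) powr \<beta>) *
      (ennreal (a powr \<beta>) * emeasure N' (space N') + ennreal (\<beta> * ?c * a powr \<beta> * ?P))"
    by (intro mult_left_mono add_right_mono one) auto
  also have "\<dots> \<le> ennreal ((1 / 4) powr \<beta>) * (\<integral>\<^sup>+x. ennreal ((a / max a (u x)) powr \<beta>) \<partial>N')"
    using u01 c low by (intro mult_left_mono layer_cake_lower[OF fin _ _ a \<beta>]) (auto simp: N'_def)
  also have "\<dots> = (\<integral>\<^sup>+x. ennreal ((1 / 4) powr \<beta>) * (indicator ?H x * ennreal ((a / max a (u x)) powr \<beta>)) \<partial>N)"
    unfolding N'_def by (simp add: nn_integral_density nn_integral_cmult)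
  also have "\<dots> \<le> (\<integral>\<^sup>+x. ennreal ((1 - mobius a (u x)) powr \<beta>) \<partial>N)"
  proof (intro nn_integral_mono)
    fix x assume x: "x \<in> space N"
    show "ennreal ((1 / 4) powr \<beta>) * (indicator ?H x * ennreal ((a / max a (u x)) powr \<beta>))
        \<le> ennreal ((1 - mobius a (u x)) powr \<beta>)"
    proof (cases "u x \<le> 1 / 2")
      case True
      have "ennreal ((1 / 4) powr \<beta>) * ennreal ((a / max a (u x)) powr \<beta>) = ennreal (((a / max a (u x)) / 4) powr \<beta>)"
        using a by (subst ennreal_mult[symmetric]) (auto simp: powr_mult[symmetric] mult.commute)
      also have "\<dots> \<le> ennreal ((1 - mobius a (u x)) powr \<beta>)"
        using True one_minus_mobius(2)[OF a, of "u x"] u01[OF x] a \<beta>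
        by (intro ennreal_leI powr_mono2) auto
      finally show ?thesis using True x by simp
    qed simp
  qed
  also have "\<dots> = ennreal (\<integral>x. (1 - mobius a (u x)) powr \<beta> \<partial>N)"
    by (rule nn_integral_eq_integral[OF defect_integrable[OF N u u01 a(1) \<beta>]]) auto
  finally show ?thesis
    by (subst (asm) ennreal_le_iff) (auto intro: integral_nonneg)
qed

section \<open>Orders of magnitude\<close>

lemma same_orderI:
  assumes "0 < c1" "0 < c2" "\<And>t. 0 \<le> t \<Longrightarrow> c1 * b t \<le> a t" "\<And>t. 0 \<le> t \<Longrightarrow> a t \<le> c2 * b t"
  shows "a \<asymp> b"
  using assms unfolding same_order_def by blast

lemma same_order_cong:
  assumes "a \<asymp> b" "\<And>t. 0 \<le> t \<Longrightarrow> a' t = a t" "\<And>t. 0 \<le> t \<Longrightarrow> b' t = b t"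
  shows "a' \<asymp> b'"
  using assms unfolding same_order_def by simp

lemma same_order_trans:
  assumes "a \<asymp> b" "b \<asymp> d"
  shows "a \<asymp> d"
proof -
  obtain c1 c2 where c: "0 < c1" "0 < c2" "\<And>t. 0 \<le> t \<Longrightarrow> c1 * b t \<le> a t \<and> a t \<le> c2 * b t"
    using assms(1) unfolding same_order_def by blast
  obtain d1 d2 where d: "0 < d1" "0 < d2" "\<And>t. 0 \<le> t \<Longrightarrow> d1 * d t \<le> b t \<and> b t \<le> d2 * d t"
    using assms(2) unfolding same_order_def by blast
  show ?thesis
  proof (rule same_orderI[of "c1 * d1" "c2 * d2"])
    fix t :: real assume t: "0 \<le> t"
    have "c1 * (d1 * d t) \<le> c1 * b t" "c2 * b t \<le> c2 * (d2 * d t)"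
      using c(1,2) d(3)[OF t] by auto
    then show "c1 * d1 * d t \<le> a t" "a t \<le> c2 * d2 * d t"
      using c(3)[OF t] by (simp_all only: mult.assoc) linarith+
  qed (use c d in auto)
qed

lemma same_order_cmult: "0 < c \<Longrightarrow> (\<lambda>t. c * a t) \<asymp> a"
  by (rule same_orderI[of c c]) auto

lemma same_order_sqrt:
  assumes "a \<asymp> b"
  shows "(\<lambda>t. sqrt (a t)) \<asymp> (\<lambda>t. sqrt (b t))"
proof -
  obtain c1 c2 where c: "0 < c1" "0 < c2" "\<And>t. 0 \<le> t \<Longrightarrow> c1 * b t \<le> a t \<and> a t \<le> c2 * b t"
    using assms unfolding same_order_def by blast
  show ?thesis
    by (rule same_orderI[of "sqrt c1" "sqrt c2"]) (use c in \<open>auto simp: real_sqrt_mult[symmetric]\<close>)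
qed

section \<open>Comparison of the clock with time\<close>

text \<open>A monotonicity criterion that accepts one-sided derivatives at the left end point.\<close>

lemma mono_from_derivative:
  assumes "\<And>t. 0 \<le> t \<Longrightarrow> (g has_real_derivative g' t) (at t within {0..})"
    and "\<And>t. 0 \<le> t \<Longrightarrow> 0 \<le> g' t" and "0 \<le> T"
  shows "g 0 \<le> g (T :: real)"
proof -
  have "\<exists>x\<in>{0..T}. g T - g 0 = (\<lambda>h. h * g' x) (T - 0)"
    using assms(1,3)
    by (intro mvt_very_simple)
      (auto simp: has_field_derivative_def mult_commute_abs intro: has_derivative_subset[where s = "{0..}"])
  then obtain x where "0 \<le> x" "g T - g 0 = T * g' x" by auto
  then show ?thesis using assms(2)[of x] assms(3) mult_nonneg_nonneg[of T "g' x"] by linarith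
qed

text \<open>The lower bound on \<open>j\<close> gives \<open>S(t) \<ge> j\<^sub>0 t\<close>; hence \<open>1 - j \<le> C exp (-j\<^sub>0 t)\<close>, whose integral over
  all times is \<open>C / j\<^sub>0\<close>. This bounds \<open>t - S(t)\<close>.\<close>

lemma clock_linear:
  assumes S: "\<And>t. 0 \<le> t \<Longrightarrow> (S has_real_derivative j t) (at t within {0..})" and S0: "S 0 = 0"
    and j0: "0 < j0" and j: "\<And>t. 0 \<le> t \<Longrightarrow> j0 \<le> j t" "\<And>t. 0 \<le> t \<Longrightarrow> j t \<le> 1"
    and C: "0 \<le> C" and defect: "\<And>t. 0 \<le> t \<Longrightarrow> 1 - j t \<le> C * exp (- S t)"
  obtains K where "0 \<le> K" "\<And>t. 0 \<le> t \<Longrightarrow> t - K \<le> S t \<and> S t \<le> t \<and> 0 \<le> S t"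
proof
  show "0 \<le> C / j0" using C j0 by simp
  fix T :: real assume T: "0 \<le> T"
  have lin: "j0 * t \<le> S t" if t: "0 \<le> t" for t
  proof -
    have "S 0 - j0 * 0 \<le> S t - j0 * t"
      by (rule mono_from_derivative[where g' = "\<lambda>t. j t - j0"])
        (auto intro!: derivative_eq_intros S that simp: j)
    then show ?thesis by (simp add: S0)
  qed
  have "0 - S 0 \<le> T - S T"
    by (rule mono_from_derivative[where g' = "\<lambda>t. 1 - j t"]) (auto intro!: derivative_eq_intros S T simp: j)
  then have up: "S T \<le> T" by (simp add: S0)
  have "S 0 - 0 - (C / j0) * exp (- j0 * 0) \<le> S T - T - (C / j0) * exp (- j0 * T)"
  proof (rule mono_from_derivative[where g' = "\<lambda>t. j t - 1 + C * exp (- j0 * t)"])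
    fix t :: real assume t: "0 \<le> t"
    show "((\<lambda>t. S t - t - (C / j0) * exp (- j0 * t)) has_real_derivative j t - 1 + C * exp (- j0 * t)) (at t within {0..})"
      using j0 by (auto intro!: derivative_eq_intros S[OF t])
    have "C * exp (- S t) \<le> C * exp (- j0 * t)"
      using lin[OF t] C by (intro mult_left_mono) auto
    then show "0 \<le> j t - 1 + C * exp (- j0 * t)" using defect[OF t] by linarith
  qed (rule T)
  moreover have "0 \<le> (C / j0) * exp (- j0 * T)" using C j0 by simp
  ultimately have "T - C / j0 \<le> S T" by (simp add: S0)
  then show "T - C / j0 \<le> S T \<and> S T \<le> T \<and> 0 \<le> S T"
    using up lin[OF T] j0 T by (meson mult_nonneg_nonneg less_imp_le order.trans)
qed

lemma flux_inner:
  assumes \<mu>: "\<mu> \<in> sphere_prob" and e: "e \<in> unit_sphere"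
  shows "flux \<mu> \<bullet> e = (\<integral>v. 2 * height e v - 1 \<partial>\<mu>)"
proof -
  interpret prob_space \<mu> using sphere_prob_space(3)[OF \<mu>] .
  have "(\<lambda>v. v) \<in> borel_measurable sphere_borel"
    by (intro borel_measurable_continuous_on_restrict continuous_intros)
  then have "(\<lambda>v. v) \<in> borel_measurable \<mu>"
    using sphere_prob_space(2)[OF \<mu>] by (simp cong: measurable_cong_sets)
  then have "integrable \<mu> (\<lambda>v. v)"
    using sphere_prob_space(1)[OF \<mu>] by (intro integrable_const_bound[where B = 1]) auto
  then have "flux \<mu> \<bullet> e = (\<integral>v. v \<bullet> e \<partial>\<mu>)"
    unfolding flux_def by (intro integral_inner_left[symmetric])
  also have "\<dots> = (\<integral>v. 2 * height e v - 1 \<partial>\<mu>)"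
    by (intro Bochner_Integration.integral_cong refl) (simp add: height_def field_simps)
  finally show ?thesis .
qed

text \<open>As the flux always points in the direction \<open>e\<close>, its component along \<open>e\<close> is its norm, which is positive
  because normalising the zero vector would not give a unit vector. Weak continuity makes \<open>j\<close> continuous, so
  its primitive is differentiable.\<close>

lemma clock_exists:
  fixes f0 :: "'a::euclidean_space measure"
  assumes sol: "is_solution f0 f" and e: "e \<in> unit_sphere"
    and dir: "\<And>t. 0 \<le> t \<Longrightarrow> flux (f t) /\<^sub>R norm (flux (f t)) = e"
  obtains S j where "S 0 = 0"
    "\<And>t. 0 \<le> t \<Longrightarrow> (S has_real_derivative j t) (at t within {0..})"
    "\<And>t. 0 \<le> t \<Longrightarrow> flux (f t) = j t *\<^sub>R e" "\<And>t. 0 \<le> t \<Longrightarrow> 0 < j t"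
    "\<And>t. 0 \<le> t \<Longrightarrow> j t = (\<integral>v. 2 * height e v - 1 \<partial>f t)"
proof -
  define j where "j t = (\<integral>v. 2 * height e v - 1 \<partial>f t)" for t
  have fs: "f t \<in> sphere_prob" if "0 \<le> t" for t using sol that by (simp add: is_solution_def)
  have norm_flux: "flux (f t) = norm (flux (f t)) *\<^sub>R e" "0 < norm (flux (f t))" if "0 \<le> t" for t
  proof -
    have "norm (flux (f t)) \<noteq> 0" using dir[OF that] e by auto
    then show "flux (f t) = norm (flux (f t)) *\<^sub>R e" "0 < norm (flux (f t))"
      using arg_cong[OF dir[OF that], of "\<lambda>x. norm (flux (f t)) *\<^sub>R x"] by auto
  qed
  have j_norm: "j t = norm (flux (f t))" if "0 \<le> t" for t
  proof -
    have "e \<bullet> e = 1" using e by (simp add: dot_square_norm)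
    then have "flux (f t) \<bullet> e = norm (flux (f t))"
      by (subst norm_flux(1)[OF that]) simp
    then show ?thesis by (simp add: j_def flux_inner[OF fs[OF that] e])
  qed
  have J: "flux (f t) = j t *\<^sub>R e" "0 < j t" if "0 \<le> t" for t
    using norm_flux[OF that] j_norm[OF that] by auto
  have "continuous_on unit_sphere (\<lambda>v. 2 * height e v - 1)" by (intro continuous_intros)
  then have cj: "continuous_on {0..} j" using sol unfolding is_solution_def j_def by blast
  have S: "((\<lambda>t. integral {0..t} j) has_real_derivative j t) (at t within {0..})" if t: "0 \<le> t" for t
  proof -
    have "((\<lambda>t. integral {0..t} j) has_real_derivative j t) (at t within {0..t + 1})"
      using t by (intro integral_has_real_derivative continuous_on_subset[OF cj]) auto
    moreover have "at t within {0..t + 1} = at t within {0..}"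
      using t by (intro at_within_nhd[of t "{..<t + 1}"]) auto
    ultimately show ?thesis by simp
  qed
  show ?thesis
    by (rule that[of "\<lambda>t. integral {0..t} j" j]) (use S J in \<open>auto simp: j_def\<close>)
qed

lemma exp_clock_order:
  assumes K: "0 \<le> K" "\<And>t. 0 \<le> t \<Longrightarrow> t - K \<le> S t \<and> S t \<le> t \<and> 0 \<le> S t" and k: "0 \<le> k"
  shows "(\<lambda>t. exp (- k * S t)) \<asymp> (\<lambda>t. exp (- k * t))"
    and "(\<lambda>t. (1 + 2 * S t) * exp (- k * S t)) \<asymp> (\<lambda>t. (1 + t) * exp (- k * t))"
proof -
  have ex: "exp (- k * t) \<le> exp (- k * S t)" "exp (- k * S t) \<le> exp (k * K) * exp (- k * t)" if "0 \<le> t" for t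
  proof -
    show "exp (- k * t) \<le> exp (- k * S t)" using K(2)[OF that] k by (simp add: mult_left_mono)
    have "k * (t - K) \<le> k * S t" using K(2)[OF that] k by (simp add: mult_left_mono)
    then show "exp (- k * S t) \<le> exp (k * K) * exp (- k * t)"
      by (simp add: exp_add[symmetric] algebra_simps)
  qed
  show "(\<lambda>t. exp (- k * S t)) \<asymp> (\<lambda>t. exp (- k * t))"
    by (rule same_orderI[of 1 "exp (k * K)"]) (use ex in auto)
  show "(\<lambda>t. (1 + 2 * S t) * exp (- k * S t)) \<asymp> (\<lambda>t. (1 + t) * exp (- k * t))"
  proof (rule same_orderI[of "1 / (1 + K)" "2 * exp (k * K)"])
    fix t :: real assume t: "0 \<le> t"
    note Kt = K(2)[OF t]
    have "1 + t \<le> 1 + K + (1 + K) * (2 * S t)"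
    proof -
      have "0 \<le> K * (2 * S t)" using K(1) Kt by simp
      then show ?thesis using Kt unfolding distrib_right mult_1 by linarith
    qed
    then have "1 + t \<le> (1 + K) * (1 + 2 * S t)" by (simp add: algebra_simps)
    then have "1 / (1 + K) * (1 + t) \<le> 1 + 2 * S t"
      using K(1) by (simp add: field_simps)
    then have "1 / (1 + K) * (1 + t) * exp (- k * t) \<le> (1 + 2 * S t) * exp (- k * S t)"
      using ex(1)[OF t] Kt by (intro mult_mono) auto
    then show "1 / (1 + K) * ((1 + t) * exp (- k * t)) \<le> (1 + 2 * S t) * exp (- k * S t)"
      by simp
    have "(1 + 2 * S t) * exp (- k * S t) \<le> (2 * (1 + t)) * (exp (k * K) * exp (- k * t))"
      using ex(2)[OF t] Kt t by (intro mult_mono) auto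
    then show "(1 + 2 * S t) * exp (- k * S t) \<le> 2 * exp (k * K) * ((1 + t) * exp (- k * t))"
      by (simp only: mult_ac)
  qed (use K in auto)
qed

text \<open>The size of \<open>a\<^sup>\<beta> (1 + \<beta> \<integral>\<^sub>a\<^sup>1 r\<^bsup>\<alpha> - \<beta> - 1\<^esup> dr)\<close> at \<open>a = exp (-2 S)\<close>: the integral converges as
  \<open>a\<close> tends to \<open>0\<close> if \<open>\<beta> < \<alpha>\<close>, equals \<open>2 S\<close> if \<open>\<beta> = \<alpha>\<close>, and is of order \<open>a\<^bsup>\<alpha> - \<beta>\<^esup>\<close> if
  \<open>\<alpha> < \<beta>\<close>.\<close>

lemma defect_profile_order:
  assumes K: "0 \<le> K" "\<And>t. 0 \<le> t \<Longrightarrow> t - K \<le> S t \<and> S t \<le> t \<and> 0 \<le> S t"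
    and \<alpha>: "0 < \<alpha>" and \<beta>: "0 < \<beta>"
  defines "Q \<equiv> \<lambda>t. exp (- 2 * S t) powr \<beta> * (1 + \<beta> * power_integral (\<alpha> - \<beta>) (exp (- 2 * S t)))"
  shows "\<beta> < \<alpha> \<Longrightarrow> Q \<asymp> (\<lambda>t. exp (- (2 * \<beta>) * t))"
    and "\<alpha> = \<beta> \<Longrightarrow> Q \<asymp> (\<lambda>t. (1 + t) * exp (- (2 * \<beta>) * t))"
    and "\<alpha> < \<beta> \<Longrightarrow> Q \<asymp> (\<lambda>t. exp (- (2 * \<alpha>) * t))"
proof -
  have pw: "exp (- 2 * S t) powr k = exp (- (2 * k) * S t)" for t k
    by (simp add: powr_def algebra_simps)
  { assume less: "\<beta> < \<alpha>"
    have "Q \<asymp> (\<lambda>t. exp (- (2 * \<beta>) * S t))"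
    proof (rule same_orderI[of 1 "1 + \<beta> / (\<alpha> - \<beta>)"])
      fix t :: real assume t: "0 \<le> t"
      have "0 \<le> power_integral (\<alpha> - \<beta>) (exp (- 2 * S t))" "power_integral (\<alpha> - \<beta>) (exp (- 2 * S t)) \<le> 1 / (\<alpha> - \<beta>)"
        using K(2)[OF t] less power_integral_nonneg[of "exp (- 2 * S t)" "\<alpha> - \<beta>"]
        by (auto simp: power_integral_def divide_right_mono)
      then have "1 \<le> 1 + \<beta> * power_integral (\<alpha> - \<beta>) (exp (- 2 * S t))"
        "1 + \<beta> * power_integral (\<alpha> - \<beta>) (exp (- 2 * S t)) \<le> 1 + \<beta> / (\<alpha> - \<beta>)"
        using \<beta> mult_left_mono[of "power_integral (\<alpha> - \<beta>) (exp (- 2 * S t))" "1 / (\<alpha> - \<beta>)" \<beta>] by auto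
      then show "1 * exp (- (2 * \<beta>) * S t) \<le> Q t" "Q t \<le> (1 + \<beta> / (\<alpha> - \<beta>)) * exp (- (2 * \<beta>) * S t)"
        unfolding Q_def pw by (simp_all only: mult.commute[of "exp _"]) (intro mult_right_mono; simp)+
    qed (use less \<beta> in \<open>auto intro: add_pos_pos\<close>)
    from this exp_clock_order(1)[OF K, of "2 * \<beta>"] \<beta>
    show "Q \<asymp> (\<lambda>t. exp (- (2 * \<beta>) * t))" by (auto intro: same_order_trans) }
  { assume eq: "\<alpha> = \<beta>"
    have "Q \<asymp> (\<lambda>t. (1 + 2 * S t) * exp (- (2 * \<beta>) * S t))"
    proof (rule same_orderI[of "min 1 \<beta>" "max 1 \<beta>"])
      fix t :: real assume t: "0 \<le> t"
      have Q: "Q t = (1 + \<beta> * (2 * S t)) * exp (- (2 * \<beta>) * S t)"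
        unfolding Q_def pw by (simp add: eq power_integral_def)
      have s: "0 \<le> 2 * S t" using K(2)[OF t] by simp
      have "min 1 \<beta> * (2 * S t) \<le> \<beta> * (2 * S t)" "\<beta> * (2 * S t) \<le> max 1 \<beta> * (2 * S t)"
        using s by (intro mult_right_mono; simp)+
      then have "min 1 \<beta> * (1 + 2 * S t) \<le> 1 + \<beta> * (2 * S t)" "1 + \<beta> * (2 * S t) \<le> max 1 \<beta> * (1 + 2 * S t)"
        unfolding distrib_left by linarith+
      then show "min 1 \<beta> * ((1 + 2 * S t) * exp (- (2 * \<beta>) * S t)) \<le> Q t"
        "Q t \<le> max 1 \<beta> * ((1 + 2 * S t) * exp (- (2 * \<beta>) * S t))"
        unfolding Q mult.assoc[symmetric] by (intro mult_right_mono; simp)+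
    qed (use \<beta> in auto)
    from this exp_clock_order(2)[OF K, of "2 * \<beta>"] \<beta>
    show "Q \<asymp> (\<lambda>t. (1 + t) * exp (- (2 * \<beta>) * t))" by (auto intro: same_order_trans) }
  { assume less: "\<alpha> < \<beta>"
    define g where "g = \<beta> / (\<beta> - \<alpha>)"
    have g: "1 \<le> g" using less \<alpha> by (simp add: g_def)
    have "Q \<asymp> (\<lambda>t. exp (- (2 * \<alpha>) * S t))"
    proof (rule same_orderI[of 1 g])
      fix t :: real assume t: "0 \<le> t"
      define x where "x = exp (2 * (\<beta> - \<alpha>) * S t)"
      have x: "1 \<le> x" using less K(2)[OF t] by (simp add: x_def)
      have "power_integral (\<alpha> - \<beta>) (exp (- 2 * S t)) = (x - 1) / (\<beta> - \<alpha>)"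
      proof -
        have "exp (- 2 * S t) powr (\<alpha> - \<beta>) = x"
          unfolding pw x_def by (simp add: algebra_simps)
        then show ?thesis
          unfolding power_integral_def using less by (simp add: field_simps)
      qed
      then have Q: "Q t = exp (- (2 * \<beta>) * S t) * (1 + g * (x - 1))"
        unfolding Q_def pw by (simp add: g_def)
      have E: "exp (- (2 * \<alpha>) * S t) = exp (- (2 * \<beta>) * S t) * x"
        by (simp add: x_def exp_add[symmetric] algebra_simps)
      have "1 * (x - 1) \<le> g * (x - 1)" using x g by (intro mult_right_mono) auto
      then have "x \<le> 1 + g * (x - 1)" "1 + g * (x - 1) \<le> g * x"
        using g by (simp_all add: algebra_simps)
      then show "1 * exp (- (2 * \<alpha>) * S t) \<le> Q t" "Q t \<le> g * exp (- (2 * \<alpha>) * S t)"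
        unfolding Q E mult.left_commute[of g] by (simp_all only: mult_1) (intro mult_left_mono; simp)+
    qed (use g in auto)
    from this exp_clock_order(1)[OF K, of "2 * \<alpha>"] \<alpha>
    show "Q \<asymp> (\<lambda>t. exp (- (2 * \<alpha>) * t))" by (auto intro: same_order_trans) }
qed

section \<open>The rates of convergence\<close>

theorem proposition7:
  fixes e :: "real ^ 'n"
    and f0 :: "(real ^ 'n) measure"
    and \<rho> :: "real ^ 'n \<Rightarrow> real"
    and m M :: real
    and f :: "real \<Rightarrow> (real ^ 'n) measure"
  assumes "CARD('n) \<ge> 2"
    and "e \<in> unit_sphere"
    and "f0 \<in> sphere_prob"
    and "\<rho> \<in> borel_measurable sphere_borel"
    and "f0 = density sphere_measure (\<lambda>v. ennreal (\<rho> v))"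
    and "0 < m" and "m < M"
    and "\<forall>v\<in>unit_sphere. m \<le> \<rho> v \<and> \<rho> v \<le> M"
    and "is_solution f0 f"
    and "flux f0 \<noteq> 0"
    and "\<forall>t\<ge>0. flux (f t) /\<^sub>R norm (flux (f t)) = e"
  shows "(\<lambda>t. W1 (f t) (return sphere_borel e)) \<asymp>
           (\<lambda>t. if CARD('n) = 2 then (1 + t) * exp (- t) else exp (- t))
       \<and> (\<lambda>t. W2 (f t) (return sphere_borel e)) \<asymp>
           (\<lambda>t. if CARD('n) = 2 then exp (- t / 2)
                else if CARD('n) = 3 then sqrt (1 + t) * exp (- t)
                else exp (- t))"
proof -
  note e = assms(2) and f0 = assms(3) and sol = assms(9)
  define \<alpha> where "\<alpha> = (real DIM(real ^ 'n) - 1) / 2"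
  have \<alpha>_card: "\<alpha> = (real CARD('n) - 1) / 2" by (simp add: \<alpha>_def)
  have \<alpha>: "1 / 2 \<le> \<alpha>" using assms(1) by (simp add: \<alpha>_card)
  let ?h = "height e"
  let ?cap = "\<lambda>r. {v \<in> space f0. ?h v \<le> r}"
  have space: "space f0 = unit_sphere" by (rule sphere_prob_space(1)[OF f0])
  have \<rho>_bounds: "m \<le> \<rho> v \<and> \<rho> v \<le> M" if "v \<in> unit_sphere" for v
    using assms(8) that by blast
  obtain c C where c: "0 < c" and C: "0 < C"
    and caps: "\<And>r. 0 < r \<Longrightarrow> r \<le> 1 \<Longrightarrow> ennreal (c * r powr \<alpha>) \<le> emeasure f0 {v \<in> unit_sphere. ?h v \<le> r}"
      "\<And>r. 0 < r \<Longrightarrow> r \<le> 1 \<Longrightarrow> emeasure f0 {v \<in> unit_sphere. ?h v \<le> r} \<le> ennreal (C * r powr \<alpha>)"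
    by (rule density_cap_bounds[OF e assms(4,5,6) \<rho>_bounds, folded \<alpha>_def]) blast+
  note ge = caps(1)[folded space] and le = caps(2)[folded space]
  note prob = sphere_prob_space(3)[OF f0]
  have meas: "?h \<in> borel_measurable f0" by (rule sphere_prob_measurable[OF f0 continuous_on_height])
  have h01: "0 \<le> ?h v \<and> ?h v \<le> 1" if "v \<in> space f0" for v
    using height_bounds[OF e, of v] that by (simp add: space)
  have dir: "flux (f t) /\<^sub>R norm (flux (f t)) = e" if "0 \<le> t" for t
    using assms(11) that by blast
  obtain S j where S0: "S 0 = 0"
    and S: "\<And>t. 0 \<le> t \<Longrightarrow> (S has_real_derivative j t) (at t within {0..})"
    and J: "\<And>t. 0 \<le> t \<Longrightarrow> flux (f t) = j t *\<^sub>R e" and jpos: "\<And>t. 0 \<le> t \<Longrightarrow> 0 < j t"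
    and j: "\<And>t. 0 \<le> t \<Longrightarrow> j t = (\<integral>v. 2 * ?h v - 1 \<partial>f t)"
    by (rule clock_exists[OF sol e dir]) blast+
  define a where "a t = exp (- 2 * S t)" for t
  define R where "R \<beta> t = (\<integral>v. (1 - mobius (a t) (?h v)) powr \<beta> \<partial>f0)" for \<beta> t
  have S_nonneg: "0 \<le> S t" if "0 \<le> t" for t
    using mono_from_derivative[OF S _ that] jpos S0 by (simp add: less_imp_le)
  have a: "0 < a t" "a t \<le> 1" if "0 \<le> t" for t using S_nonneg[OF that] by (auto simp: a_def)
  have mob: "0 \<le> mobius (a t) (?h v)" "mobius (a t) (?h v) \<le> 1" if "0 \<le> t" "v \<in> space f0" for t v
    using mobius_bounds[OF a(1)[OF that(1)]] h01[OF that(2)] by auto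
  have R_eq: "(\<integral>v. (1 - ?h v) powr \<beta> \<partial>f t) = R \<beta> t" if "0 \<le> t" "0 < \<beta>" for t \<beta>
    unfolding R_def a_def
  proof (rule transport[OF sol e J S S0 _ that(1), where p = "\<lambda>y. (1 - y) powr \<beta>"])
    show "continuous_on {0..1} (\<lambda>y. (1 - y) powr \<beta>)"
      using that(2) by (intro continuous_on_powr' continuous_intros) auto
  qed
  have fs: "f t \<in> sphere_prob" if "0 \<le> t" for t using sol that by (simp add: is_solution_def)
  have R1: "(\<integral>v. 1 - ?h v \<partial>f t) = R 1 t" if "0 \<le> t" for t
  proof -
    have "(\<integral>v. 1 - ?h v \<partial>f t) = (\<integral>v. (1 - ?h v) powr 1 \<partial>f t)"
      by (intro Bochner_Integration.integral_cong refl)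
        (use height_bounds[OF e] sphere_prob_space(1)[OF fs[OF that]] in auto)
    then show ?thesis using R_eq[OF that, of 1] by simp
  qed
  have j_eq: "j t = 1 - 2 * R 1 t" if "0 \<le> t" for t
  proof -
    interpret prob_space "f t" using sphere_prob_space(3)[OF fs[OF that]] .
    have "integrable (f t) ?h" by (intro sphere_prob_integrable[OF fs[OF that]] continuous_on_height)
    then show ?thesis unfolding j[OF that] R1[OF that, symmetric] by (simp add: prob_space)
  qed
  \<comment> \<open>Heights only increase along the flow, so the flux never falls below its initial value.\<close>
  have j0: "j 0 \<le> j t" if t: "0 \<le> t" for t
  proof -
    have "R 1 t \<le> R 1 0"
      unfolding R_def
    proof (rule integral_mono)
      show "integrable f0 (\<lambda>v. (1 - mobius (a t) (?h v)) powr 1)" "integrable f0 (\<lambda>v. (1 - mobius (a 0) (?h v)) powr 1)"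
        by (rule defect_integrable[OF prob meas h01 a(1)]; use t in simp)+
      fix v assume v: "v \<in> space f0"
      have "?h v \<le> mobius (a t) (?h v)" using mobius_ge[OF a[OF t]] h01[OF v] by simp
      moreover have "a 0 = 1" by (simp add: a_def S0)
      ultimately show "(1 - mobius (a t) (?h v)) powr 1 \<le> (1 - mobius (a 0) (?h v)) powr 1"
        using mob[OF t v] by (intro powr_mono2) auto
    qed
    then show ?thesis using j_eq[OF t] j_eq[of 0] by simp
  qed
  have defect: "1 - j t \<le> 2 * (1 + 2 * C) * exp (- S t)" if t: "0 \<le> t" for t
  proof -
    have "R 1 t \<le> a t powr 1 * (1 + 1 * C * power_integral (1 / 2 - 1) (a t))"
      unfolding R_def
    proof (rule defect_integral_le[OF prob meas h01 a[OF t]])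
      fix r :: real assume r: "0 < r" "r \<le> 1"
      \<comment> \<open>The exponent of the planar case gives a bound in every dimension.\<close>
      have "C * r powr \<alpha> \<le> C * r powr (1 / 2)"
        using C r \<alpha> by (intro mult_left_mono powr_mono') auto
      then show "emeasure f0 (?cap r) \<le> ennreal (C * r powr (1 / 2))"
        using le[OF r] by (meson ennreal_leI order.trans)
    qed (use C in auto)
    also have "power_integral (1 / 2 - 1) (a t) = 2 * (exp (S t) - 1)"
      by (simp add: power_integral_def a_def powr_def)
    also have "a t powr 1 * (1 + 1 * C * (2 * (exp (S t) - 1))) \<le> (1 + 2 * C) * exp (- S t)"
    proof -
      have "a t = exp (- S t) * exp (- S t)" by (simp add: a_def exp_add[symmetric])
      then have "a t powr 1 * (1 + 1 * C * (2 * (exp (S t) - 1))) =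
          exp (- S t) * (exp (- S t) + 2 * C * (exp (- S t) * exp (S t) - exp (- S t)))"
        by (simp add: algebra_simps)
      also have "\<dots> \<le> exp (- S t) * (1 + 2 * C * 1)"
      proof -
        have "exp (- S t) * exp (S t) = 1" by (simp add: exp_minus)
        then show ?thesis using S_nonneg[OF t] C by (intro mult_left_mono add_mono) auto
      qed
      finally show ?thesis by (simp add: mult.commute)
    qed
    finally show ?thesis using j_eq[OF t] by (simp only: mult.assoc)
  qed
  have j1: "j t \<le> 1" if "0 \<le> t" for t
    using j_eq[OF that] by (simp add: R_def integral_nonneg)
  have C': "0 \<le> 2 * (1 + 2 * C)" using C by simp
  obtain K where K: "0 \<le> K" "\<And>t. 0 \<le> t \<Longrightarrow> t - K \<le> S t \<and> S t \<le> t \<and> 0 \<le> S t"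
    by (rule clock_linear[OF S S0 jpos[OF order.refl] j0 j1 C' defect]) blast+
  \<comment> \<open>\<open>R (1 / 2)\<close> governs \<open>W1\<close> and \<open>R 1\<close> governs both \<open>W2\<close> and the flux.\<close>
  have profile: "R \<beta> \<asymp> (\<lambda>t. exp (- 2 * S t) powr \<beta> * (1 + \<beta> * power_integral (\<alpha> - \<beta>) (exp (- 2 * S t))))"
    if \<beta>: "0 < \<beta>" for \<beta>
  proof (rule same_orderI)
    show "0 < (1 / 4) powr \<beta> * (c * (1 / 2) powr \<alpha>)" "0 < 1 + C" using c C by auto
    fix t :: real assume t: "0 \<le> t"
    let ?P = "power_integral (\<alpha> - \<beta>) (exp (- 2 * S t))"
    show "(1 / 4) powr \<beta> * (c * (1 / 2) powr \<alpha>) * (exp (- 2 * S t) powr \<beta> * (1 + \<beta> * ?P)) \<le> R \<beta> t"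
      unfolding R_def a_def[symmetric] using c by (intro defect_integral_ge prob meas h01 a t \<beta> ge) auto
    have P: "0 \<le> ?P" using S_nonneg[OF t] by (intro power_integral_nonneg) auto
    have "R \<beta> t \<le> exp (- 2 * S t) powr \<beta> * (1 + \<beta> * C * ?P)"
      unfolding R_def a_def[symmetric] using C by (intro defect_integral_le prob meas h01 a t \<beta> le) auto
    also have "\<dots> \<le> exp (- 2 * S t) powr \<beta> * ((1 + C) * (1 + \<beta> * ?P))"
      using C P \<beta> by (intro mult_left_mono) (auto simp: algebra_simps)
    finally show "R \<beta> t \<le> (1 + C) * (exp (- 2 * S t) powr \<beta> * (1 + \<beta> * ?P))" by (simp add: mult_ac)
  qed
  have order: "\<beta> < \<alpha> \<Longrightarrow> R \<beta> \<asymp> (\<lambda>t. exp (- (2 * \<beta>) * t))"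
    "\<alpha> = \<beta> \<Longrightarrow> R \<beta> \<asymp> (\<lambda>t. (1 + t) * exp (- (2 * \<beta>) * t))"
    "\<alpha> < \<beta> \<Longrightarrow> R \<beta> \<asymp> (\<lambda>t. exp (- (2 * \<alpha>) * t))" if "0 < \<beta>" for \<beta>
    using same_order_trans[OF profile[OF that]] defect_profile_order[OF K _ that, of \<alpha>] \<alpha> by auto
  have W1: "W1 (f t) (return sphere_borel e) = 2 * R (1 / 2) t" if t: "0 \<le> t" for t
  proof -
    have "(\<integral>v. norm (v - e) \<partial>f t) = (\<integral>v. 2 * ((1 - ?h v) powr (1 / 2)) \<partial>f t)"
      by (intro Bochner_Integration.integral_cong refl)
        (use norm_diff_height(2)[OF e] height_bounds[OF e] sphere_prob_space(1)[OF fs[OF t]] in \<open>auto simp: powr_half_sqrt\<close>)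
    then show ?thesis using R_eq[OF t, of "1 / 2"] by (simp add: W1_return[OF fs[OF t] e])
  qed
  have W2: "W2 (f t) (return sphere_borel e) = sqrt (4 * R 1 t)" if t: "0 \<le> t" for t
  proof -
    have "(\<integral>v. (norm (v - e))\<^sup>2 \<partial>f t) = (\<integral>v. 4 * (1 - ?h v) \<partial>f t)"
      by (intro Bochner_Integration.integral_cong refl)
        (use norm_diff_height(1)[OF e] sphere_prob_space(1)[OF fs[OF t]] in auto)
    also have "\<dots> = 4 * R 1 t" by (simp only: integral_mult_right_zero R1[OF t])
    finally show ?thesis by (simp add: W2_return[OF fs[OF t] e])
  qed
  have n: "CARD('n) = 2 \<and> \<alpha> = 1 / 2 \<or> CARD('n) = 3 \<and> \<alpha> = 1 \<or> 3 < CARD('n) \<and> 1 < \<alpha>"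
    using assms(1) by (auto simp: \<alpha>_card)
  show ?thesis
  proof
    have "R (1 / 2) \<asymp> (\<lambda>t. if CARD('n) = 2 then (1 + t) * exp (- t) else exp (- t))"
      using n order[of "1 / 2"] by auto
    then have "(\<lambda>t. 2 * R (1 / 2) t) \<asymp> (\<lambda>t. if CARD('n) = 2 then (1 + t) * exp (- t) else exp (- t))"
      using same_order_trans[OF same_order_cmult[of 2]] by simp
    then show "(\<lambda>t. W1 (f t) (return sphere_borel e)) \<asymp>
        (\<lambda>t. if CARD('n) = 2 then (1 + t) * exp (- t) else exp (- t))"
      by (rule same_order_cong) (auto simp: W1)
    have "R 1 \<asymp> (\<lambda>t. if CARD('n) = 2 then exp (- t)
        else if CARD('n) = 3 then (1 + t) * exp (- 2 * t) else exp (- 2 * t))"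
      using n
    proof (elim disjE conjE)
      assume "CARD('n) = 2" "\<alpha> = 1 / 2"
      then show ?thesis using order(3)[of 1] unfolding \<open>\<alpha> = 1 / 2\<close> by simp
    qed (use order(1,2)[of 1] in auto)
    then have "(\<lambda>t. 4 * R 1 t) \<asymp> (\<lambda>t. if CARD('n) = 2 then exp (- t)
        else if CARD('n) = 3 then (1 + t) * exp (- 2 * t) else exp (- 2 * t))"
      using same_order_trans[OF same_order_cmult[of 4]] by simp
    from same_order_sqrt[OF this]
    show "(\<lambda>t. W2 (f t) (return sphere_borel e)) \<asymp>
        (\<lambda>t. if CARD('n) = 2 then exp (- t / 2)
             else if CARD('n) = 3 then sqrt (1 + t) * exp (- t) else exp (- t))"
    proof (rule same_order_cong)
      have sq: "sqrt (exp x) = exp (x / 2)" for x :: real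
        by (rule real_sqrt_unique) (auto simp: power2_eq_square exp_add[symmetric])
      fix t :: real
      show "(if CARD('n) = 2 then exp (- t / 2)
             else if CARD('n) = 3 then sqrt (1 + t) * exp (- t) else exp (- t)) =
          sqrt (if CARD('n) = 2 then exp (- t) else if CARD('n) = 3 then (1 + t) * exp (- 2 * t) else exp (- 2 * t))"
        by (simp add: real_sqrt_mult sq)
    qed (simp add: W2)
  qed
qed

end
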